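(* Let $\pi=(\pi_i)_{1\le i\le m}$ be a probability distribution. For each $n\ge1$ let $U^{[n]}=(U^{[n]}_{ij})_{1\le i,j\le m}$ be a unitary matrix and $\chi^{[n]}=(\chi^{[n]}_i(k))_{1\le i\le m,\,1\le k\le d}$ a complex matrix with $\sum_k|\chi^{[n]}_i(k)|^2=1$ for every $i$, and let $A^{[n]}_k=(a^{[n]}_{k;ij})$ be the $m\times m$ matrices with $a^{[n]}_{k;ij}=U^{[n]}_{ij}\chi^{[n]}_i(k)$. For $N\ge1$ let $$|\psi_N\rangle=\sum_{k_1,\dots,k_N}\mathrm{Tr}\big(A^{[1]}_{k_1}\cdots A^{[N]}_{k_N}\big)|k_1\cdots k_N\rangle\in\mathcal K^{\otimes N},\qquad \rho_N=\frac1m|\psi_N\rangle\langle\psi_N|,$$ and let $\rho_{O;N}=\mathrm{Tr}_{\mathcal H^{\otimes(N+1)}}\big(|\Psi_{H,O;N}\rangle\langle\Psi_{H,O;N}|\big)$ be the observation density matrix of the associated entangled hidden Markov model. Then $$S(\rho_N\,\|\,\rho_{O;N})\ \ge\ \frac1m\sum_{k_1,\dots,k_N}\big|\mathrm{Tr}\big(A^{[1]}_{k_1}\cdots A^{[N]}_{k_N}\big)\big|^2\,\log\left(\frac{\big|\mathrm{Tr}\big(A^{[1]}_{k_1}\cdots A^{[N]}_{k_N}\big)\big|^2}{m^{3/2}\;\pi^\dagger\Big(\prod_{\ell=1}^N\big|A^{[\ell]}_{k_\ell}\big|^2_\diamond\Big)e}\right),$$ where the sum is over all sequences $(k_1,\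dots,k_N)\in\{1,\dots,d\}^N$.
   Context: $\mathcal H$ is a complex Hilbert space of dimension $m$ with orthonormal basis $(e_i)_{1\le i\le m}$ and $\mathcal K$ is a complex Hilbert space of dimension $d$ with orthonormal basis $(|k\rangle)_{1\le k\le d}$; $|k_1\cdots k_N\rangle=|k_1\rangle\otimes\cdots\otimes|k_N\rangle$. State vector of the entangled hidden Markov model: $$|\Psi_{H,O;N}\rangle=\sum_{i_1,\dots,i_{N+1}}\sum_{k_1,\dots,k_N}\sqrt{\pi_{i_1}}\Big(\prod_{\ell=1}^NU^{[\ell]}_{i_\ell i_{\ell+1}}\chi^{[\ell]}_{i_\ell}(k_\ell)\Big)\,e_{i_1}\otimes\cdots\otimes e_{i_{N+1}}\otimes|k_1\cdots k_N\rangle\in\mathcal H^{\otimes(N+1)}\otimes\mathcal K^{\otimes N}.$$ $\mathrm{Tr}_{\mathcal H^{\otimes(N+1)}}$ is the partial trace over $\mathcal H^{\otimes(N+1)}$. $\diamond$ is the Schur (entrywise) product of $m\times m$ matrices, $\overline{A}$ is the entrywise complex conjugate, and $|A|^2_\diamond=A\diamond\overline A$ (the matrix of squared moduli of entries). The product $\prod_{\ell=1}^N$ is the ordinary matrix product in the order $\ell=1,\dots,N$. $\pi^\dagger=\sum_i\pi_ie_i^\dagger$ (row vector) and $e=\frac1{\sqrt m}\sum_je_j$ (column vector). Quantum relative entropy: for positive semidefinite operators $\rho,\sigma$ on the same finite-dimensional Hilbert space, $S(\rho\|\sigma)=\mathrm{Tr}(\rho\log\rho)-\mathrm{Tr}(\rho\log\sigma)$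 if $\mathrm{supp}(\rho)\subseteq\mathrm{supp}(\sigma)$ (logarithms taken on supports), and $S(\rho\|\sigma)=+\infty$ otherwise. Conventions: a summand with $\mathrm{Tr}(A^{[1]}_{k_1}\cdots A^{[N]}_{k_N})=0$ is $0$; a summand with nonzero trace and vanishing denominator is $+\infty$. *)

theory Defs
  imports
    "Jordan_Normal_Form.Schur_Decomposition"
    "Jordan_Normal_Form.Matrix_Kernel"
    "HOL-Library.Extended_Real"
    "HOL-Library.FuncSet"
begin

text \<open>
  The Hilbert spaces are given with orthonormal bases, so they are taken in coordinates: the space
  of dimension \<open>n\<close> is \<open>carrier_vec n\<close> over \<open>complex\<close>, its basis is \<open>unit_vec n 0, \<dots>, unit_vec n (n - 1)\<close>,
  and operators are square matrices. Basis labels (\<open>i\<close>, \<open>k\<close>) are therefore shifted to start at 0,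
  while the time index \<open>l\<close> runs over \<open>1, \<dots>, N\<close> (up to \<open>N + 1\<close> for the hidden sequence).
  A sequence of labels of length \<open>N\<close> is an extensional function on \<open>{1..N}\<close>.
\<close>

definition label_seqs :: "nat \<Rightarrow> nat \<Rightarrow> (nat \<Rightarrow> nat) set" where
  "label_seqs n N = {1..N} \<rightarrow>\<^sub>E {0..<n}"


subsection \<open>Matrices\<close>

definition unitary_mat :: "complex mat \<Rightarrow> bool" where
  "unitary_mat U \<longleftrightarrow> square_mat U \<and> inverts_mat U (mat_adjoint U) \<and> inverts_mat (mat_adjoint U) U"

definition mat_trace :: "'a :: comm_monoid_add mat \<Rightarrow> 'a" where
  "mat_trace A = (\<Sum>i<dim_row A. A $$ (i, i))"

text \<open>\<open>mat_seq_prod n N B\<close> is the ordered product \<open>B 1 * B 2 * \<dots> * B N\<close> of \<open>n \<times> n\<close> matrices.\<close>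

definition mat_seq_prod :: "nat \<Rightarrow> nat \<Rightarrow> (nat \<Rightarrow> complex mat) \<Rightarrow> complex mat" where
  "mat_seq_prod n N B = foldr (*) (map B [1..<Suc N]) (1\<^sub>m n)"

definition schur_prod :: "complex mat \<Rightarrow> complex mat \<Rightarrow> complex mat" (infixl \<open>\<diamond>\<close> 70) where
  "A \<diamond> B = mat (dim_row A) (dim_col A) (\<lambda>(i, j). A $$ (i, j) * B $$ (i, j))"

definition schur_abs_sq :: "complex mat \<Rightarrow> complex mat" where
  "schur_abs_sq A = A \<diamond> map_mat cnj A"

text \<open>The operator \<open>|v\<rangle>\<langle>w|\<close>.\<close>

definition ket_bra :: "complex vec \<Rightarrow> complex vec \<Rightarrow> complex mat" where
  "ket_bra v w = mat (dim_vec v) (dim_vec w) (\<lambda>(i, j). v $ i * cnj (w $ j))"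


subsection \<open>Tensor products\<close>

text \<open>
  The tensor product of spaces of dimensions \<open>p\<close> and \<open>q\<close> is realised as the space of dimension
  \<open>p * q\<close>; the basis vector with labels \<open>(a, r)\<close> has position \<open>a * q + r\<close>.
\<close>

definition tensor_vec :: "complex vec \<Rightarrow> complex vec \<Rightarrow> complex vec" (infixr \<open>\<otimes>\<^sub>v\<close> 75) where
  "u \<otimes>\<^sub>v v = vec (dim_vec u * dim_vec v) (\<lambda>a. u $ (a div dim_vec v) * v $ (a mod dim_vec v))"

text \<open>\<open>basis_ket n N x\<close> is \<open>|x\<^sub>1\<rangle> \<otimes> \<dots> \<otimes> |x\<^sub>N\<rangle>\<close>; the empty tensor product is the one-dimensional space.\<close>

definition basis_ket :: "nat \<Rightarrow> nat \<Rightarrow> (nat \<Rightarrow> nat) \<Rightarrow> complex vec" where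
  "basis_ket n N x = foldr (\<otimes>\<^sub>v) (map (\<lambda>l. unit_vec n (x l)) [1..<Suc N]) (unit_vec 1 0)"

text \<open>Partial trace over the first factor (dimension \<open>p\<close>) of a tensor product of dimension \<open>p * q\<close>.\<close>

definition ptrace_fst :: "nat \<Rightarrow> nat \<Rightarrow> complex mat \<Rightarrow> complex mat" where
  "ptrace_fst p q X = mat q q (\<lambda>(r, s). \<Sum>a<p. X $$ (a * q + r, a * q + s))"


subsection \<open>Quantum relative entropy\<close>

definition spectral_decomp :: "complex mat \<Rightarrow> complex mat \<Rightarrow> (nat \<Rightarrow> real) \<Rightarrow> bool" where
  "spectral_decomp A V ev \<longleftrightarrow>
     V \<in> carrier_mat (dim_row A) (dim_row A) \<and> unitary_mat V \<and>
     A = V * mat_diag (dim_row A) (\<lambda>i. complex_of_real (ev i)) * mat_adjoint V"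

text \<open>
  Functional calculus for Hermitian matrices. The result does not depend on the decomposition
  chosen by \<open>SOME\<close>, see \<open>herm_fun_eq\<close> below.
\<close>

definition herm_fun :: "(real \<Rightarrow> real) \<Rightarrow> complex mat \<Rightarrow> complex mat" where
  "herm_fun f A = (case (SOME (V, ev). spectral_decomp A V ev) of (V, ev) \<Rightarrow>
     V * mat_diag (dim_row A) (\<lambda>i. complex_of_real (f (ev i))) * mat_adjoint V)"

lemma mat_adjoint_carrier: "V \<in> carrier_mat n n \<Longrightarrow> mat_adjoint V \<in> carrier_mat n n"
  unfolding mat_adjoint_def by auto

lemma herm_fun_unique:
  assumes "spectral_decomp A V ev" and "spectral_decomp A W ew"
  shows "V * mat_diag (dim_row A) (\<lambda>i. complex_of_real (f (ev i))) * mat_adjoint V =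
         W * mat_diag (dim_row A) (\<lambda>i. complex_of_real (f (ew i))) * mat_adjoint W"
proof -
  define n where "n = dim_row A"
  define D where "D g e = mat_diag n (\<lambda>i. complex_of_real (g ((e :: nat \<Rightarrow> real) i)))"
    for g :: "real \<Rightarrow> real" and e
  define V' W' where "V' = mat_adjoint V" and "W' = mat_adjoint W"
  have V: "V \<in> carrier_mat n n" and W: "W \<in> carrier_mat n n"
    using assms by (auto simp: spectral_decomp_def n_def)
  then have V': "V' \<in> carrier_mat n n" and W': "W' \<in> carrier_mat n n"
    by (auto simp: V'_def W'_def mat_adjoint_carrier)
  have D: "D g e \<in> carrier_mat n n" for g e by (simp add: D_def)
  have inv: "V * V' = 1\<^sub>m n" "V' * V = 1\<^sub>m n" "W * W' = 1\<^sub>m n" "W' * W = 1\<^sub>m n"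
    using assms V W V' W'
    by (auto simp: spectral_decomp_def unitary_mat_def inverts_mat_def V'_def W'_def)
  have eq: "V * D id ev * V' = W * D id ew * W'"
    using assms by (simp add: spectral_decomp_def D_def n_def V'_def W'_def)
  note assoc = assoc_mult_mat[of _ n n _ n _ n]
  have mult: "P * Q \<in> carrier_mat n n" if "P \<in> carrier_mat n n" "Q \<in> carrier_mat n n"
    for P Q :: "complex mat" using that by (rule mult_carrier_mat)
  have cancel: "P * (Q * B) = B"
    if "P * Q = 1\<^sub>m n" "P \<in> carrier_mat n n" "Q \<in> carrier_mat n n" "B \<in> carrier_mat n n"
    for P Q B :: "complex mat" using that assoc[of P Q B] by simp
  note cancels = cancel[OF inv(1) V V'] cancel[OF inv(2) V' V]
    cancel[OF inv(3) W W'] cancel[OF inv(4) W' W]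
  note norm = assoc mult V V' W W' D inv cancels
  define X where "X = W' * V"
  have X: "X \<in> carrier_mat n n" using W' V by (simp add: X_def)
  have l: "X * D id ev = W' * (V * D id ev * V') * V"
    using right_mult_one_mat[OF D] by (simp add: X_def norm)
  have r: "D id ew * X = W' * (W * D id ew * W') * V"
    by (simp add: X_def norm)
  have com: "X * D id ev = D id ew * X" using l r eq by simp
  have "X * D f ev = D f ew * X"
  proof (rule eq_matI)
    fix i j assume "i < dim_row (D f ew * X)" "j < dim_col (D f ew * X)"
    then have i: "i < n" and j: "j < n" using D[of f ew] X by auto
    have "(X * D id ev) $$ (i, j) = (D id ew * X) $$ (i, j)" using com by simp
    then have "X $$ (i, j) = 0 \<or> ev j = ew i"
      using i j by (simp add: D_def mat_diag_mult_left[OF X] mat_diag_mult_right[OF X])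
    then show "(X * D f ev) $$ (i, j) = (D f ew * X) $$ (i, j)"
      using i j by (auto simp: D_def mat_diag_mult_left[OF X] mat_diag_mult_right[OF X])
  qed (use D[of f ew] D[of f ev] X in auto)
  then have "W * (X * D f ev) * V' = W * (D f ew * X) * V'" by simp
  then have "V * D f ev * V' = W * D f ew * W'"
    using right_mult_one_mat[OF W'] by (simp add: X_def norm)
  then show ?thesis by (simp add: D_def n_def V'_def W'_def)
qed

lemma herm_fun_eq:
  assumes "spectral_decomp A V ev"
  shows "herm_fun f A =
    V * mat_diag (dim_row A) (\<lambda>i. complex_of_real (f (ev i))) * mat_adjoint V"
proof -
  have "case (SOME (V, ev). spectral_decomp A V ev) of (V, ev) \<Rightarrow> spectral_decomp A V ev"
    by (rule someI[where x = "(V, ev)"]) (simp add: assms)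
  then show ?thesis
    unfolding herm_fun_def using herm_fun_unique[OF _ assms] by (auto split: prod.splits)
qed

text \<open>Natural logarithm on the support: eigenvalue 0 is sent to 0.\<close>

definition mat_log :: "complex mat \<Rightarrow> complex mat" where
  "mat_log = herm_fun (\<lambda>x. if x = 0 then 0 else ln x)"

text \<open>The support is the orthogonal complement of the kernel.\<close>

definition mat_supp :: "complex mat \<Rightarrow> complex vec set" where
  "mat_supp A = {v \<in> carrier_vec (dim_col A). \<forall>w \<in> mat_kernel A. v \<bullet>c w = 0}"

text \<open>
  Meant for positive semidefinite matrices of the same size, of any trace. Both traces are
  then real, so taking the real part loses nothing.
\<close>

definition rel_entropy :: "complex mat \<Rightarrow> complex mat \<Rightarrow> ereal" where
  "rel_entropy \<rho> \<sigma> =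
     (if mat_supp \<rho> \<subseteq> mat_supp \<sigma>
      then ereal (Re (mat_trace (\<rho> * mat_log \<rho>) - mat_trace (\<rho> * mat_log \<sigma>)))
      else \<infinity>)"


subsection \<open>The entangled hidden Markov model\<close>

definition ehmm_mat ::
  "nat \<Rightarrow> (nat \<Rightarrow> complex mat) \<Rightarrow> (nat \<Rightarrow> complex mat) \<Rightarrow> nat \<Rightarrow> nat \<Rightarrow> complex mat" where
  "ehmm_mat m U \<chi> n k = mat m m (\<lambda>(i, j). U n $$ (i, j) * \<chi> n $$ (i, k))"

definition ehmm_state ::
  "nat \<Rightarrow> nat \<Rightarrow> (nat \<Rightarrow> real) \<Rightarrow> (nat \<Rightarrow> complex mat) \<Rightarrow> (nat \<Rightarrow> complex mat) \<Rightarrow> nat \<Rightarrow> complex vec"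
  where
  "ehmm_state m d \<pi> U \<chi> N =
     finsum_vec TYPE(complex) (m ^ (N + 1) * d ^ N)
       (\<lambda>(i, k).
          (complex_of_real (sqrt (\<pi> (i 1))) *
           (\<Prod>l = 1..N. U l $$ (i l, i (l + 1)) * \<chi> l $$ (i l, k l)))
          \<cdot>\<^sub>v (basis_ket m (N + 1) i \<otimes>\<^sub>v basis_ket d N k))
       (label_seqs m (N + 1) \<times> label_seqs d N)"

definition ehmm_obs_density ::
  "nat \<Rightarrow> nat \<Rightarrow> (nat \<Rightarrow> real) \<Rightarrow> (nat \<Rightarrow> complex mat) \<Rightarrow> (nat \<Rightarrow> complex mat) \<Rightarrow> nat \<Rightarrow> complex mat"
  where
  "ehmm_obs_density m d \<pi> U \<chi> N =
     ptrace_fst (m ^ (N + 1)) (d ^ N)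
       (ket_bra (ehmm_state m d \<pi> U \<chi> N) (ehmm_state m d \<pi> U \<chi> N))"


subsection \<open>The matrix product state\<close>

text \<open>Matrix product coefficient \<open>Tr (A 1 (k 1) * \<dots> * A N (k N))\<close>.\<close>

definition mps_coeff :: "nat \<Rightarrow> (nat \<Rightarrow> nat \<Rightarrow> complex mat) \<Rightarrow> nat \<Rightarrow> (nat \<Rightarrow> nat) \<Rightarrow> complex" where
  "mps_coeff m A N k = mat_trace (mat_seq_prod m N (\<lambda>l. A l (k l)))"

definition mps_vec :: "nat \<Rightarrow> nat \<Rightarrow> (nat \<Rightarrow> nat \<Rightarrow> complex mat) \<Rightarrow> nat \<Rightarrow> complex vec" where
  "mps_vec m d A N =
     finsum_vec TYPE(complex) (d ^ N) (\<lambda>k. mps_coeff m A N k \<cdot>\<^sub>v basis_ket d N k) (label_seqs d N)"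

definition mps_density :: "nat \<Rightarrow> nat \<Rightarrow> (nat \<Rightarrow> nat \<Rightarrow> complex mat) \<Rightarrow> nat \<Rightarrow> complex mat" where
  "mps_density m d A N = (1 / of_nat m) \<cdot>\<^sub>m ket_bra (mps_vec m d A N) (mps_vec m d A N)"


subsection \<open>The lower bound\<close>

definition uniform_vec :: "nat \<Rightarrow> complex vec" where
  "uniform_vec m = vec m (\<lambda>_. complex_of_real (1 / sqrt (real m)))"

text \<open>
  The number \<open>\<pi>\<^sup>\<dagger> (\<Prod>\<^sub>l |A l (k l)|\<^sup>2) e\<close>: all matrices and vectors involved have
  nonnegative real entries, so its complex value equals its real part. The bullet is the bilinear
  row-times-column product.
\<close>

definition classical_weight ::
  "nat \<Rightarrow> (nat \<Rightarrow> real) \<Rightarrow> (nat \<Rightarrow> nat \<Rightarrow> complex mat) \<Rightarrow> nat \<Rightarrow> (nat \<Rightarrow> nat) \<Rightarrow> real" where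
  "classical_weight m \<pi> A N k =
     Re (vec m (\<lambda>i. complex_of_real (\<pi> i)) \<bullet>
         (mat_seq_prod m N (\<lambda>l. schur_abs_sq (A l (k l))) *\<^sub>v uniform_vec m))"

text \<open>\<open>t log (t / q)\<close> with the conventions for vanishing arguments.\<close>

definition log_ratio_term :: "real \<Rightarrow> real \<Rightarrow> ereal" where
  "log_ratio_term t q = (if t = 0 then 0 else if q = 0 then \<infinity> else ereal (t * ln (t / q)))"

end

theory Submission
  imports Defs "Jordan_Normal_Form.Spectral_Radius" "HOL-Real_Asymp.Real_Asymp" "HOL-Analysis.Convex"
begin

text \<open>
  The right-hand side is the classical relative entropy of the distributions obtained by measuring
  both densities in the product basis: the diagonal entries of the observation density are
  \<open>q = sqrt m * classical_weight\<close>. Since \<open>\<rho> = c |\<psi>\<rangle>\<langle>\<psi>|\<close> has rank one, monotonicity under this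
  measurement has a short proof. Put \<open>p k = |\<psi> k|\<^sup>2\<close> and \<open>P = \<Sum> p\<close>. Weighted Cauchy--Schwarz bounds
  \<open>\<sigma>\<close> on the support of \<open>\<psi>\<close> by the diagonal operator with entries \<open>P * q k / p k\<close>, and operator
  monotonicity of the logarithm bounds \<open>\<langle>\<psi>, log \<sigma> \<psi>\<rangle>\<close> by \<open>\<Sum> p k * log (P * q k / p k)\<close>.
\<close>

subsection \<open>Spectral theorem for Hermitian matrices\<close>

lemma dim_mat_adjoint [simp]: "dim_row (mat_adjoint A) = dim_col A" "dim_col (mat_adjoint A) = dim_row A"
  by (auto simp: mat_adjoint_def)

lemma index_mat_adjoint [simp]:
  "i < dim_col A \<Longrightarrow> j < dim_row A \<Longrightarrow> mat_adjoint A $$ (i, j) = conjugate (A $$ (j, i))"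
  by (auto simp: mat_adjoint_def mat_of_rows_def)

lemma mat_adjoint_adjoint [simp]: "mat_adjoint (mat_adjoint A) = A"
  by (rule eq_matI) auto

lemma mat_adjoint_mult:
  fixes A B :: "complex mat"
  assumes "A \<in> carrier_mat n k" "B \<in> carrier_mat k p"
  shows "mat_adjoint (A * B) = mat_adjoint B * mat_adjoint A"
  using assms by (intro eq_matI) (auto simp: scalar_prod_def mult.commute)

text \<open>A left inverse of a square matrix is also a right inverse, so orthonormality of the
  columns suffices.\<close>

lemma unitary_matI:
  assumes V: "V \<in> carrier_mat n n" and VV: "mat_adjoint V * V = 1\<^sub>m n"
  shows "unitary_mat V"
  using mat_mult_left_right_inverse[OF mat_adjoint_carrier[OF V] V VV] assms
  by (auto simp: unitary_mat_def inverts_mat_def)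

lemma unitary_matD:
  assumes "unitary_mat V" "V \<in> carrier_mat n n"
  shows "mat_adjoint V * V = 1\<^sub>m n" "V * mat_adjoint V = 1\<^sub>m n"
  using assms by (auto simp: unitary_mat_def inverts_mat_def)

lemma scalar_prod_conj_self: "v \<bullet>c v = complex_of_real (\<Sum>i<dim_vec v. (cmod (v $ i))\<^sup>2)"
  by (simp add: scalar_prod_def lessThan_atLeast0 flip: complex_norm_square)

text \<open>Complete the eigenvector to a basis, orthogonalise and normalise. Gram--Schmidt keeps
  the first vector, so column 0 is still an eigenvector.\<close>

lemma unitary_extending_eigenvector:
  fixes A :: "complex mat"
  assumes A: "A \<in> carrier_mat n n" and ev: "eigenvector A v e"
  obtains W where "W \<in> carrier_mat n n" "unitary_mat W" "A *\<^sub>v col W 0 = e \<cdot>\<^sub>v col W 0"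
proof -
  have v: "v \<in> carrier_vec n" and v0: "v \<noteq> 0\<^sub>v n" and Av: "A *\<^sub>v v = e \<cdot>\<^sub>v v"
    using ev A by (auto simp: eigenvector_def)
  have n: "n \<noteq> 0" using v v0 by (metis carrier_vecD eq_vecI not_less_zero zero_carrier_vec)
  interpret cof_vec_space n "TYPE(complex)" .
  define b where "b = basis_completion v"
  note bc = basis_completion[OF v v0, folded b_def]
  have "hd b = v" "length b = n" using bc by auto
  then obtain vs where bv: "b = v # vs" using n by (cases b) auto
  define ws where "ws = gram_schmidt n b"
  have ws: "set ws \<subseteq> carrier_vec n" "corthogonal ws" "length ws = n"
    using gram_schmidt_result[OF bc(2,4,5) refl] \<open>length b = n\<close> by (auto simp: ws_def)
  have wsi: "ws ! i \<in> carrier_vec n" if "i < n" for i using ws that by auto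
  have ws0: "ws ! 0 = v"
    using gram_schmidt_hd[OF v, of vs, folded bv, folded ws_def] ws(3) n by (metis hd_conv_nth list.size(3))
  \<comment> \<open>\<open>gram_schmidt\<close> returns orthogonal but unnormalised vectors.
    \<open>r i\<close> is the norm of the \<open>i\<close>-th one, nonzero because
    \<open>corthogonal\<close> excludes zero vectors.\<close>
  define r where "r i = sqrt (\<Sum>j<n. (cmod (ws ! i $ j))\<^sup>2)" for i
  have rr: "ws ! i \<bullet>c ws ! i = complex_of_real (r i) * complex_of_real (r i)" if "i < n" for i
    using wsi[OF that] scalar_prod_conj_self[of "ws ! i"]
    by (simp add: r_def sum_nonneg flip: of_real_mult)
  have r0: "r i \<noteq> 0" if "i < n" for i
    using rr[OF that] corthogonalD[OF ws(2), of i i] ws(3) that by auto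
  define W where "W = mat n n (\<lambda>(j, i). ws ! i $ j / complex_of_real (r i))"
  have W: "W \<in> carrier_mat n n" by (simp add: W_def)
  have "mat_adjoint W * W = 1\<^sub>m n"
  proof (rule eq_matI)
    fix i j assume ij: "i < dim_row (1\<^sub>m n)" "j < dim_col (1\<^sub>m n)"
    then have "(mat_adjoint W * W) $$ (i, j) =
      (ws ! j \<bullet>c ws ! i) / (complex_of_real (r i) * complex_of_real (r j))"
      using wsi[of i] wsi[of j] W by (auto simp: scalar_prod_def W_def sum_divide_distrib mult_ac)
    also have "\<dots> = 1\<^sub>m n $$ (i, j)"
      using ij rr[of i] r0[of i] corthogonalD[OF ws(2), of j i] ws(3) by auto
    finally show "(mat_adjoint W * W) $$ (i, j) = 1\<^sub>m n $$ (i, j)" .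
  qed (use W in auto)
  then have "unitary_mat W" using unitary_matI[OF W] by simp
  moreover have "col W 0 = (1 / complex_of_real (r 0)) \<cdot>\<^sub>v v"
    using n v by (intro eq_vecI) (auto simp: W_def ws0)
  then have "A *\<^sub>v col W 0 = e \<cdot>\<^sub>v col W 0"
    using Av v A by (simp add: mult_mat_vec smult_smult_assoc mult.commute)
  ultimately show thesis using that W by blast
qed

text \<open>Deflation by induction on the dimension: in an orthonormal basis starting with an
  eigenvector, a Hermitian matrix splits into a 1 by 1 block and a smaller Hermitian block. The
  result makes \<open>herm_fun_eq\<close> applicable to both densities.\<close>

theorem hermitian_spectral_decomp:
  fixes A :: "complex mat"
  assumes "A \<in> carrier_mat n n" and "mat_adjoint A = A"
  shows "\<exists>V ev. spectral_decomp A V ev"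
  using assms
proof (induction n arbitrary: A)
  case 0
  then show ?case
    by (intro exI[of _ "1\<^sub>m 0"] exI[of _ "\<lambda>_. 0"])
       (auto simp: spectral_decomp_def unitary_mat_def inverts_mat_def intro!: eq_matI)
next
  case (Suc n)
  note A = Suc.prems(1) and herm = Suc.prems(2)
  let ?N = "Suc n"
  obtain e v where "eigenvector A v e"
    using spectrum_non_empty[OF A] by (auto simp: spectrum_def eigenvalue_def)
  then obtain W where W: "W \<in> carrier_mat ?N ?N" and uW: "unitary_mat W"
    and eig: "A *\<^sub>v col W 0 = e \<cdot>\<^sub>v col W 0"
    using unitary_extending_eigenvector[OF A] by metis
  note WW = unitary_matD[OF uW W]
  define W' where "W' = mat_adjoint W"
  have W': "W' \<in> carrier_mat ?N ?N" using W by (simp add: W'_def mat_adjoint_carrier)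
  note assoc = assoc_mult_mat[of _ ?N ?N _ ?N _ ?N]
  note mult = mult_carrier_mat[of _ ?N ?N _ ?N]
  define B where "B = W' * A * W"
  have B: "B \<in> carrier_mat ?N ?N" using A W W' by (simp add: B_def mult)
  have hermB: "mat_adjoint B = B"
    using A W W' by (simp add: B_def mat_adjoint_mult[of _ ?N ?N _ ?N] mult assoc W'_def herm)
  have cnjB: "B $$ (i, j) = cnj (B $$ (j, i))" if "i < ?N" "j < ?N" for i j
    using arg_cong[OF hermB, of "\<lambda>M. M $$ (i, j)"] that B by simp
  \<comment> \<open>The first column of \<open>B\<close> is \<open>W'\<close> applied to
    \<open>e\<close> times the first column of \<open>W\<close>, and \<open>W' * W\<close> is the
    identity.\<close>
  have col0: "B $$ (i, 0) = (if i = 0 then e else 0)" if i: "i < ?N" for i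
  proof -
    have "B = W' * (A * W)" using A W W' by (simp add: B_def assoc)
    then have "B $$ (i, 0) = row W' i \<bullet> col (A * W) 0"
      using i A W W' by simp
    also have "col (A * W) 0 = e \<cdot>\<^sub>v col W 0"
      using col_mult2[OF A W, of 0] eig by simp
    also have "row W' i \<bullet> (e \<cdot>\<^sub>v col W 0) = e * (W' * W) $$ (i, 0)"
      using i W W' by simp
    finally show ?thesis using i WW by (simp add: W'_def)
  qed
  \<comment> \<open>Hermitian symmetry carries the zeros of the first column over to the first row;
    it also makes the corner entry \<open>e\<close> real.\<close>
  have row0: "B $$ (0, i) = (if i = 0 then e else 0)" if "i < ?N" for i
    using cnjB[of 0 i] col0[of i] col0[of 0] cnjB[of 0 0] that by (auto split: if_splits)
  have e: "e = complex_of_real (Re e)"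
    using cnjB[of 0 0] col0[of 0] by (auto simp: complex_eq_iff)
  define C where "C = mat n n (\<lambda>(i, j). B $$ (Suc i, Suc j))"
  have C: "C \<in> carrier_mat n n" by (simp add: C_def)
  have "mat_adjoint C = C"
    by (rule eq_matI) (auto simp: C_def intro!: cnjB[symmetric])
  from Suc.IH[OF C this] obtain V ev where "spectral_decomp C V ev" by auto
  then have V: "V \<in> carrier_mat n n" and uV: "unitary_mat V"
    and CV: "C = V * mat_diag n (\<lambda>i. complex_of_real (ev i)) * mat_adjoint V"
    using C by (auto simp: spectral_decomp_def)
  \<comment> \<open>Direct sum of a scalar and a matrix. It respects products and adjoints, so the
    decomposition of \<open>C\<close> lifts to one of \<open>B\<close>.\<close>
  define blk where "blk x M = four_block_mat (mat 1 1 (\<lambda>_. x :: complex)) (0\<^sub>m 1 n) (0\<^sub>m n 1) M" for x M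
  have blk: "blk x M \<in> carrier_mat ?N ?N" if "M \<in> carrier_mat n n" for x M
    using that by (auto simp: blk_def)
  have blk_mult: "blk x M * blk y L = blk (x * y) (M * L)"
    if "M \<in> carrier_mat n n" "L \<in> carrier_mat n n" for x y M L
  proof -
    have "blk x M * blk y L = four_block_mat
      (mat 1 1 (\<lambda>_. x) * mat 1 1 (\<lambda>_. y) + 0\<^sub>m 1 n * 0\<^sub>m n 1)
      (mat 1 1 (\<lambda>_. x) * 0\<^sub>m 1 n + 0\<^sub>m 1 n * L)
      (0\<^sub>m n 1 * mat 1 1 (\<lambda>_. y) + M * 0\<^sub>m n 1) (0\<^sub>m n 1 * 0\<^sub>m 1 n + M * L)"
      unfolding blk_def by (rule mult_four_block_mat) (use that in auto)
    also have "\<dots> = blk (x * y) (M * L)"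
      unfolding blk_def using that by (intro cong_four_block_mat eq_matI) (auto simp: scalar_prod_def)
    finally show ?thesis .
  qed
  have blk_adj: "mat_adjoint (blk x M) = blk (cnj x) (mat_adjoint M)" if "M \<in> carrier_mat n n" for x M
    using that by (intro eq_matI) (auto simp: blk_def)
  have V': "mat_adjoint V \<in> carrier_mat n n" using V by (rule mat_adjoint_carrier)
  define P where "P = blk 1 V"
  define f where "f i = (case i of 0 \<Rightarrow> Re e | Suc j \<Rightarrow> ev j)" for i
  define D where "D = mat_diag ?N (\<lambda>i. complex_of_real (f i))"
  have D: "D \<in> carrier_mat ?N ?N" by (simp add: D_def)
  have P: "P \<in> carrier_mat ?N ?N" using V by (simp add: P_def blk)
  have one: "blk 1 (1\<^sub>m n) = 1\<^sub>m ?N"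
    by (intro eq_matI) (auto simp: blk_def)
  have PP: "mat_adjoint P * P = 1\<^sub>m ?N"
    using V V' one unitary_matD[OF uV V] by (simp add: P_def blk_adj blk_mult)
  have D_blk: "D = blk e (mat_diag n (\<lambda>i. complex_of_real (ev i)))"
    using e by (intro eq_matI) (auto simp: D_def blk_def mat_diag_def f_def split: nat.splits)
  have "P * D * mat_adjoint P = blk e C"
    using V V' by (simp add: P_def D_blk blk_adj blk_mult CV)
  also have "blk e C = B"
    using B by (intro eq_matI) (auto simp: blk_def C_def row0 col0)
  finally have PDP: "P * D * mat_adjoint P = B" .
  have P': "mat_adjoint P \<in> carrier_mat ?N ?N" using P by (rule mat_adjoint_carrier)
  have cancel: "X * (Y * Z) = Z" if "X * Y = 1\<^sub>m ?N" "X \<in> carrier_mat ?N ?N"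
    "Y \<in> carrier_mat ?N ?N" "Z \<in> carrier_mat ?N ?N" for X Y Z :: "complex mat"
    using assoc[of X Y Z] that by simp
  have adjWP: "mat_adjoint (W * P) = mat_adjoint P * W'"
    using W P by (simp add: mat_adjoint_mult W'_def)
  have WP: "W * P \<in> carrier_mat ?N ?N" using W P by (simp add: mult)
  have "mat_adjoint (W * P) * (W * P) = 1\<^sub>m ?N"
    using P P' W W' WW PP by (simp add: adjWP assoc mult cancel[OF WW(1)] W'_def)
  then have "unitary_mat (W * P)" by (rule unitary_matI[OF WP])
  moreover have "A = W * P * D * mat_adjoint (W * P)"
  proof -
    have "W * P * D * mat_adjoint (W * P) = W * (P * D * mat_adjoint P) * W'"
      using P P' W W' D by (simp add: adjWP assoc mult)
    also have "\<dots> = A"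
      using W W' A WW by (simp add: PDP B_def assoc mult cancel[OF WW(2)] W'_def)
    finally show ?thesis by simp
  qed
  ultimately show ?case
    using A WP by (intro exI[of _ "W * P"] exI[of _ f]) (auto simp: spectral_decomp_def D_def)
qed

subsection \<open>Diagonal domination and the logarithm\<close>

text \<open>
  Operator monotonicity of the logarithm is reduced to that of the resolvents: the difference of the
  two sums with \<open>ln (_ + t)\<close> in place of \<open>ln\<close> decreases in \<open>t\<close> and vanishes as \<open>t\<close> tends to infinity.
\<close>

lemma sum_ln_le_of_sum_resolvent_le:
  fixes p L b e :: "_ \<Rightarrow> real"
  assumes fin: "finite K" "finite J"
    and L: "\<And>k. k \<in> K \<Longrightarrow> L k > 0" and e: "\<And>j. j \<in> J \<Longrightarrow> e j > 0"
    and tot: "sum p K = sum b J"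
    and res: "\<And>t. t > 0 \<Longrightarrow> (\<Sum>k\<in>K. p k / (L k + t)) \<le> (\<Sum>j\<in>J. b j / (e j + t))"
  shows "(\<Sum>j\<in>J. b j * ln (e j)) \<le> (\<Sum>k\<in>K. p k * ln (L k))"
proof -
  define F where "F t = (\<Sum>k\<in>K. p k * ln (L k + t)) - (\<Sum>j\<in>J. b j * ln (e j + t))" for t
  have deriv: "(F has_real_derivative (\<Sum>k\<in>K. p k / (L k + t)) - (\<Sum>j\<in>J. b j / (e j + t))) (at t)"
    if "t \<ge> 0" for t
    unfolding F_def using L e that
    by (auto intro!: derivative_eq_intros simp: add_pos_nonneg)
  have anti: "F t \<le> F 0" if "t > 0" for t
  proof (rule DERIV_nonpos_imp_decreasing_open[of 0 t F])
    show "\<exists>y. (F has_real_derivative y) (at x) \<and> y \<le> 0" if "0 < x" "x < t" for x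
      using deriv[of x] res[of x] that by force
    show "continuous_on {0..t} F"
      by (rule DERIV_continuous_on[of _ _ "\<lambda>t. (\<Sum>k\<in>K. p k / (L k + t)) - (\<Sum>j\<in>J. b j / (e j + t))"])
         (auto intro: has_field_derivative_at_within deriv)
  qed (use that in auto)
  have ln0: "((\<lambda>t. ln (a + t) - ln t) \<longlongrightarrow> 0) at_top" for a :: real
    by real_asymp
  \<comment> \<open>Since the totals agree by \<open>tot\<close>, subtracting \<open>ln t\<close>
    from every logarithm leaves \<open>F\<close> unchanged, and each summand then tends to
    0.\<close>
  have F_eq: "F t = (\<Sum>k\<in>K. p k * (ln (L k + t) - ln t)) - (\<Sum>j\<in>J. b j * (ln (e j + t) - ln t))" for t
    by (simp add: F_def right_diff_distrib sum_subtractf tot flip: sum_distrib_right)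
  have "(F \<longlongrightarrow> (\<Sum>k\<in>K. p k * 0) - (\<Sum>j\<in>J. b j * 0)) at_top"
    unfolding F_eq by (intro tendsto_intros ln0)
  then have "(F \<longlongrightarrow> 0) at_top" by simp
  moreover have "\<forall>\<^sub>F t in at_top. F t \<le> F 0"
    using eventually_gt_at_top[of 0] by eventually_elim (rule anti)
  ultimately have "0 \<le> F 0"
    by (rule tendsto_upperbound) simp
  then show ?thesis by (simp add: F_def)
qed

text \<open>Inner products are computed in the basis formed by the columns of \<open>V\<close>. The
  hypothesis is the completeness relation of that basis, so summing over \<open>j\<close> first
  leaves only the terms with \<open>k = l\<close>.\<close>

lemma parseval_sum:
  fixes V :: "nat \<Rightarrow> nat \<Rightarrow> complex"
  assumes V: "\<And>k l. k < n \<Longrightarrow> l < n \<Longrightarrow> (\<Sum>j<n. V k j * cnj (V l j)) = of_bool (k = l)"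
  shows "(\<Sum>j<n. cnj (\<Sum>k<n. cnj (V k j) * x k) * (\<Sum>l<n. cnj (V l j) * w l))
    = (\<Sum>k<n. cnj (x k) * w k)"
proof -
  have "(\<Sum>j<n. cnj (\<Sum>k<n. cnj (V k j) * x k) * (\<Sum>l<n. cnj (V l j) * w l))
      = (\<Sum>j<n. \<Sum>k<n. \<Sum>l<n. V k j * cnj (V l j) * (cnj (x k) * w l))"
    unfolding cnj_sum sum_product by (simp add: mult_ac)
  also have "\<dots> = (\<Sum>k<n. \<Sum>l<n. \<Sum>j<n. V k j * cnj (V l j) * (cnj (x k) * w l))"
    by (subst sum.swap) (intro sum.cong refl sum.swap)
  also have "\<dots> = (\<Sum>k<n. \<Sum>l<n. of_bool (k = l) * (cnj (x k) * w l))"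
    using V by (intro sum.cong refl) (simp flip: sum_distrib_right)
  also have "\<dots> = (\<Sum>k<n. cnj (x k) * w k)"
    by (intro sum.cong refl) (simp add: of_bool_def if_distrib[of "\<lambda>x. x * _"] cong: if_cong)
  finally show ?thesis .
qed

lemma parseval_norm_sum:
  fixes V :: "nat \<Rightarrow> nat \<Rightarrow> complex"
  assumes V: "\<And>k l. k < n \<Longrightarrow> l < n \<Longrightarrow> (\<Sum>j<n. V k j * cnj (V l j)) = of_bool (k = l)"
  shows "(\<Sum>j<n. (cmod (\<Sum>k<n. cnj (V k j) * x k))\<^sup>2) = (\<Sum>k<n. (cmod (x k))\<^sup>2)"
proof -
  have *: "cnj z * z = complex_of_real ((cmod z)\<^sup>2)" for z
    by (simp only: complex_norm_square mult.commute)
  show ?thesis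
    using parseval_sum[OF V, where x = x and w = x] unfolding * of_real_sum[symmetric] of_real_eq_iff .
qed

text \<open>Cauchy--Schwarz after splitting \<open>cmod (a k)\<close> into \<open>sqrt (p k)\<close>
  and \<open>cmod (a k) / sqrt (p k)\<close>.\<close>

lemma cmod_sum_sq_le_weighted:
  assumes "finite K" "\<And>k. k \<in> K \<Longrightarrow> p k > (0 :: real)"
  shows "(cmod (\<Sum>k\<in>K. a k))\<^sup>2 \<le> (\<Sum>k\<in>K. p k) * (\<Sum>k\<in>K. (cmod (a k))\<^sup>2 / p k)"
proof -
  have nz: "p k \<noteq> 0" if "k \<in> K" for k using assms(2)[OF that] by simp
  have "(cmod (\<Sum>k\<in>K. a k))\<^sup>2 \<le> (\<Sum>k\<in>K. cmod (a k))\<^sup>2"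
    by (intro power_mono norm_sum) simp
  also have "\<dots> = (\<Sum>k\<in>K. sqrt (p k) * (cmod (a k) / sqrt (p k)))\<^sup>2"
    by (intro arg_cong[of _ _ "\<lambda>x. x\<^sup>2"] sum.cong) (auto simp: nz)
  also have "\<dots> \<le> (\<Sum>k\<in>K. (sqrt (p k))\<^sup>2) * (\<Sum>k\<in>K. (cmod (a k) / sqrt (p k))\<^sup>2)"
    by (rule Cauchy_Schwarz_ineq_sum)
  also have "\<dots> = (\<Sum>k\<in>K. p k) * (\<Sum>k\<in>K. (cmod (a k))\<^sup>2 / p k)"
    using assms by (simp add: power_divide less_imp_le)
  finally show ?thesis .
qed

text \<open>Expand \<open>\<psi> k\<close> in the eigenbasis. A vanishing sum of nonnegative terms
  leaves, for each \<open>j\<close>, either \<open>V k j = 0\<close> or \<open>ev j = 0\<close>; in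
  the second case \<psi> has no component along eigenvector \<open>j\<close>.\<close>

lemma spectral_diagonal_zero_imp_zero:
  fixes V :: "nat \<Rightarrow> nat \<Rightarrow> complex"
  assumes V: "\<And>k l. k < n \<Longrightarrow> l < n \<Longrightarrow> (\<Sum>j<n. V k j * cnj (V l j)) = of_bool (k = l)"
    and ev: "\<And>j. j < n \<Longrightarrow> ev j \<ge> (0 :: real)"
    and supp: "\<And>j. j < n \<Longrightarrow> ev j = 0 \<Longrightarrow> (\<Sum>l<n. cnj (V l j) * \<psi> l) = 0"
    and k: "k < n" and zero: "(\<Sum>j<n. ev j * (cmod (V k j))\<^sup>2) = 0"
  shows "\<psi> k = 0"
proof -
  have "\<psi> k = (\<Sum>l<n. (\<Sum>j<n. V k j * cnj (V l j)) * \<psi> l)"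
    using V k by (simp add: of_bool_def if_distrib[of "\<lambda>x. x * _"] cong: if_cong)
  also have "\<dots> = (\<Sum>j<n. V k j * (\<Sum>l<n. cnj (V l j) * \<psi> l))"
    unfolding sum_distrib_left sum_distrib_right by (subst sum.swap) (simp add: mult.assoc)
  also have "\<dots> = 0"
  proof (intro sum.neutral ballI)
    fix j assume j: "j \<in> {..<n}"
    have "ev j * (cmod (V k j))\<^sup>2 = 0"
      using zero ev j by (subst (asm) sum_nonneg_eq_0_iff) auto
    then show "V k j * (\<Sum>l<n. cnj (V l j) * \<psi> l) = 0"
      using supp[of j] j by auto
  qed
  finally show ?thesis .
qed

text \<open>Let \<sigma> have eigenvalues \<open>ev\<close> and eigenvectors the columns of
  \<open>V\<close>. Then \<open>\<beta>\<close> holds the coordinates of \<psi> in the eigenbasis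
  and \<open>q\<close> the diagonal of \<sigma>. With \<open>L\<close> the diagonal operator of
  entries \<open>P * q k / p k\<close>, the resolvent criterion asks that the quadratic form of
  \<open>(L + t)^-1\<close> at \<psi> be at most that of \<open>(\<sigma> + t)^-1\<close>.\<close>

lemma spectral_log_le_diagonal_log:
  fixes V :: "nat \<Rightarrow> nat \<Rightarrow> complex" and \<psi> :: "nat \<Rightarrow> complex" and ev :: "nat \<Rightarrow> real"
  assumes V: "\<And>k l. k < n \<Longrightarrow> l < n \<Longrightarrow> (\<Sum>j<n. V k j * cnj (V l j)) = of_bool (k = l)"
    and ev: "\<And>j. j < n \<Longrightarrow> ev j \<ge> 0"
  defines "\<beta> \<equiv> \<lambda>j. \<Sum>k<n. cnj (V k j) * \<psi> k"
    and "p \<equiv> \<lambda>k. (cmod (\<psi> k))\<^sup>2"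
    and "q \<equiv> \<lambda>k. \<Sum>j<n. ev j * (cmod (V k j))\<^sup>2"
  defines "P \<equiv> \<Sum>k<n. p k"
  assumes supp: "\<And>j. j < n \<Longrightarrow> ev j = 0 \<Longrightarrow> \<beta> j = 0"
  shows "(\<Sum>j | j < n \<and> ev j > 0. (cmod (\<beta> j))\<^sup>2 * ln (ev j))
    \<le> (\<Sum>k | k < n \<and> p k > 0. p k * ln (P * q k / p k))"
proof (rule sum_ln_le_of_sum_resolvent_le)
  let ?K = "{k. k < n \<and> p k > 0}" and ?J = "{j. j < n \<and> ev j > 0}"
  define L where "L k = P * q k / p k" for k
  have P: "P = sum p ?K"
    unfolding P_def by (rule sum.mono_neutral_right) (auto simp: p_def)
  have q0: "\<psi> k = 0" if "k < n" "q k = 0" for k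
    using V ev supp that unfolding \<beta>_def q_def
    by (rule spectral_diagonal_zero_imp_zero)
  have q_nonneg: "q k \<ge> 0" for k using ev by (auto simp: q_def intro!: sum_nonneg)
  have L_pos: "L k > 0" if "k \<in> ?K" for k
  proof -
    have "P > 0" unfolding P using that by (intro sum_pos) auto
    moreover have "q k > 0" using q0[of k] q_nonneg[of k] that by (force simp: p_def less_le)
    ultimately show ?thesis using that by (simp add: L_def)
  qed
  then show "P * q k / p k > 0" if "k \<in> ?K" for k using that by (simp add: L_def)
  \<comment> \<open>Indices outside \<open>?J\<close> have eigenvalue 0, where
    \<open>\<beta>\<close> vanishes by \<open>supp\<close>.\<close>
  have restrict_J: "(\<Sum>j\<in>?J. (cmod (\<beta> j))\<^sup>2 * g j) = (\<Sum>j<n. (cmod (\<beta> j))\<^sup>2 * g j)" for g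
    using supp ev by (intro sum.mono_neutral_left) (force simp: less_le)+
  show "sum p ?K = (\<Sum>j\<in>?J. (cmod (\<beta> j))\<^sup>2)"
    using restrict_J[of "\<lambda>_. 1"] parseval_norm_sum[OF V, where x = \<psi>] P
    unfolding P_def p_def \<beta>_def by simp
  fix t :: real assume t: "t > 0"
  \<comment> \<open>The trial vector \<open>x\<close> is \<open>(L + t)^-1\<close> applied to \<psi>
    on \<open>?K\<close>, and \<open>y\<close> holds its coordinates in the eigenbasis.\<close>
  define x where "x k = (if k \<in> ?K then \<psi> k / of_real (L k + t) else 0)" for k
  define y where "y j = (\<Sum>k<n. cnj (V k j) * x k)" for j
  define R where "R = (\<Sum>k\<in>?K. p k / (L k + t))"
  have x_sq: "(cmod (x k))\<^sup>2 = p k / (L k + t)\<^sup>2" if "k \<in> ?K" for k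
    using that L_pos[OF that] t by (simp add: x_def p_def norm_divide power_divide del: of_real_add)
  \<comment> \<open>Domination of \<sigma> by \<open>L\<close> on vectors supported in
    \<open>?K\<close>: bound each \<open>y j\<close> by Cauchy--Schwarz with weights
    \<open>p\<close>; summing against \<open>ev j\<close> then turns the squared moduli of
    \<open>V k j\<close> into \<open>q k\<close>.\<close>
  have quad: "(\<Sum>j<n. ev j * (cmod (y j))\<^sup>2) \<le> (\<Sum>k\<in>?K. L k * (cmod (x k))\<^sup>2)"
  proof -
    have y: "y j = (\<Sum>k\<in>?K. cnj (V k j) * x k)" for j
      unfolding y_def by (rule sum.mono_neutral_right) (auto simp: x_def)
    have "(\<Sum>j<n. ev j * (cmod (y j))\<^sup>2)
      \<le> (\<Sum>j<n. ev j * (P * (\<Sum>k\<in>?K. (cmod (cnj (V k j) * x k))\<^sup>2 / p k)))"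
      unfolding y P using ev by (intro sum_mono mult_left_mono cmod_sum_sq_le_weighted) auto
    also have "\<dots> = (\<Sum>j<n. \<Sum>k\<in>?K. P * (ev j * (cmod (V k j))\<^sup>2) / p k * (cmod (x k))\<^sup>2)"
      by (simp add: sum_distrib_left norm_mult power_mult_distrib mult_ac)
    also have "\<dots> = (\<Sum>k\<in>?K. L k * (cmod (x k))\<^sup>2)"
      by (subst sum.swap) (simp add: L_def q_def sum_distrib_left sum_distrib_right sum_divide_distrib)
    finally show ?thesis .
  qed
  have "(\<Sum>j<n. (cmod (y j))\<^sup>2) = (\<Sum>k<n. (cmod (x k))\<^sup>2)"
    unfolding y_def by (rule parseval_norm_sum[OF V])
  also have "\<dots> = (\<Sum>k\<in>?K. (cmod (x k))\<^sup>2)"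
    by (rule sum.mono_neutral_right) (auto simp: x_def)
  finally have "(\<Sum>j<n. (ev j + t) * (cmod (y j))\<^sup>2) \<le> (\<Sum>k\<in>?K. (L k + t) * (cmod (x k))\<^sup>2)"
    using quad by (simp add: distrib_right sum.distrib flip: sum_distrib_left)
  also have "\<dots> = R"
    unfolding R_def
  proof (intro sum.cong refl)
    fix k assume k: "k \<in> ?K"
    then have "L k + t \<noteq> 0" using L_pos[OF k] t by simp
    then show "(L k + t) * (cmod (x k))\<^sup>2 = p k / (L k + t)"
      unfolding x_sq[OF k] by (simp add: power2_eq_square)
  qed
  finally have yR: "(\<Sum>j<n. (ev j + t) * (cmod (y j))\<^sup>2) \<le> R" .
  \<comment> \<open>\<open>R\<close> is also the inner product of \<open>x\<close> with \<psi>,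
    which Parseval moves to the eigenbasis.\<close>
  have "complex_of_real R = (\<Sum>k\<in>?K. cnj (x k) * \<psi> k)"
    unfolding R_def of_real_sum
    by (intro sum.cong refl) (simp add: x_def p_def mult.commute flip: complex_norm_square)
  also have "\<dots> = (\<Sum>k<n. cnj (x k) * \<psi> k)"
    by (rule sum.mono_neutral_left) (auto simp: x_def)
  also have "\<dots> = (\<Sum>j<n. cnj (y j) * \<beta> j)"
    unfolding y_def \<beta>_def by (rule parseval_sum[OF V, symmetric])
  finally have "R = Re (\<Sum>j<n. cnj (y j) * \<beta> j)" by (metis Re_complex_of_real)
  also have "\<dots> \<le> (\<Sum>j<n. cmod (y j) * cmod (\<beta> j))"
    by (rule order_trans[OF complex_Re_le_cmod]) (rule sum_norm_le, simp add: norm_mult)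
  \<comment> \<open>Arithmetic-geometric mean inequality with the two factors rescaled by
    \<open>sqrt (ev j + t)\<close>. By \<open>yR\<close> the first half contributes at most
    \<open>R / 2\<close>, which is then absorbed on the left.\<close>
  also have "\<dots> \<le> (\<Sum>j<n. ((ev j + t) * (cmod (y j))\<^sup>2 + (cmod (\<beta> j))\<^sup>2 / (ev j + t)) / 2)"
  proof (rule sum_mono)
    have am_gm: "u * v \<le> (u\<^sup>2 + v\<^sup>2) / 2" for u v :: real
      using sum_squares_bound[of u v] by (simp add: field_simps)
    fix j assume "j \<in> {..<n}"
    then have s: "ev j + t > 0" using ev[of j] t by simp
    define a where "a = sqrt (ev j + t)"
    have a: "a > 0" "ev j + t = a\<^sup>2" using s by (auto simp: a_def)
    have "cmod (y j) * cmod (\<beta> j) = (a * cmod (y j)) * (cmod (\<beta> j) / a)" using a by simp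
    also have "\<dots> \<le> ((a * cmod (y j))\<^sup>2 + (cmod (\<beta> j) / a)\<^sup>2) / 2"
      by (rule am_gm)
    finally show "cmod (y j) * cmod (\<beta> j)
      \<le> ((ev j + t) * (cmod (y j))\<^sup>2 + (cmod (\<beta> j))\<^sup>2 / (ev j + t)) / 2"
      unfolding a(2) by (simp add: power_mult_distrib power_divide)
  qed
  also have "\<dots> \<le> (R + (\<Sum>j<n. (cmod (\<beta> j))\<^sup>2 / (ev j + t))) / 2"
    using yR by (simp add: sum.distrib flip: sum_divide_distrib)
  finally have "R \<le> (\<Sum>j<n. (cmod (\<beta> j))\<^sup>2 / (ev j + t))" by simp
  also have "\<dots> = (\<Sum>j\<in>?J. (cmod (\<beta> j))\<^sup>2 / (ev j + t))"
    using restrict_J[of "\<lambda>j. 1 / (ev j + t)"] by simp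
  finally show "(\<Sum>k\<in>?K. p k / (P * q k / p k + t)) \<le> (\<Sum>j\<in>?J. (cmod (\<beta> j))\<^sup>2 / (ev j + t))"
    by (simp add: R_def L_def)
qed auto

subsection \<open>Relative entropy of a rank one operator\<close>

lemma index_conj_mat_diag:
  fixes V :: "complex mat"
  assumes "V \<in> carrier_mat n n" "k < n" "l < n"
  shows "(V * mat_diag n g * mat_adjoint V) $$ (k, l) = (\<Sum>j<n. V $$ (k, j) * g j * cnj (V $$ (l, j)))"
  using assms
  by (simp add: mat_diag_mult_right[of V n n] scalar_prod_def lessThan_atLeast0)

context
  fixes A V :: "complex mat" and ev :: "nat \<Rightarrow> real" and n :: nat
  assumes A: "A \<in> carrier_mat n n" and sd: "spectral_decomp A V ev"
begin

lemma spectral_decomp_carrier: "V \<in> carrier_mat n n" "unitary_mat V"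
  using sd A by (auto simp: spectral_decomp_def)

lemma spectral_decomp_rows:
  "k < n \<Longrightarrow> l < n \<Longrightarrow> (\<Sum>j<n. V $$ (k, j) * cnj (V $$ (l, j))) = of_bool (k = l)"
  using arg_cong[OF unitary_matD(2)[OF spectral_decomp_carrier(2,1)], of "\<lambda>M. M $$ (k, l)"]
    spectral_decomp_carrier(1)
  by (simp add: scalar_prod_def lessThan_atLeast0)

lemma index_herm_fun:
  "k < n \<Longrightarrow> l < n \<Longrightarrow>
    herm_fun f A $$ (k, l) = (\<Sum>j<n. V $$ (k, j) * complex_of_real (f (ev j)) * cnj (V $$ (l, j)))"
  using A by (simp add: herm_fun_eq[OF sd] index_conj_mat_diag[OF spectral_decomp_carrier(1)])

lemma herm_fun_carrier: "herm_fun f A \<in> carrier_mat n n"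
  using A mult_carrier_mat[OF mult_carrier_mat[OF spectral_decomp_carrier(1) mat_diag_dim]
    mat_adjoint_carrier[OF spectral_decomp_carrier(1)]]
  by (simp add: herm_fun_eq[OF sd])

lemma index_spectral_decomp:
  "k < n \<Longrightarrow> l < n \<Longrightarrow>
    A $$ (k, l) = (\<Sum>j<n. V $$ (k, j) * complex_of_real (ev j) * cnj (V $$ (l, j)))"
  using A sd index_conj_mat_diag[OF spectral_decomp_carrier(1)]
  by (simp add: spectral_decomp_def)

lemma spectral_decomp_diagonal_entry:
  assumes "k < n"
  shows "A $$ (k, k) = complex_of_real (\<Sum>j<n. ev j * (cmod (V $$ (k, j)))\<^sup>2)"
  unfolding index_spectral_decomp[OF assms assms] of_real_sum
  by (intro sum.cong refl) (simp only: of_real_mult complex_norm_square mult_ac)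

lemma mat_mult_eigenvector:
  assumes "k < n" "j < n"
  shows "(\<Sum>l<n. A $$ (k, l) * V $$ (l, j)) = complex_of_real (ev j) * V $$ (k, j)"
proof -
  let ?D = "mat_diag n (\<lambda>i. complex_of_real (ev i))"
  note V = spectral_decomp_carrier(1)
  note V' = mat_adjoint_carrier[OF V]
  have VD: "V * ?D \<in> carrier_mat n n" using V by (rule mult_carrier_mat) simp
  have "A * V = V * ?D * mat_adjoint V * V"
    using sd A by (simp add: spectral_decomp_def)
  also have "\<dots> = V * ?D"
    using unitary_matD(1)[OF spectral_decomp_carrier(2) V] assoc_mult_mat[OF VD V' V]
      right_mult_one_mat[OF VD] by simp
  finally have "(A * V) $$ (k, j) = (V * ?D) $$ (k, j)" by simp
  then show ?thesis
    using assms A V by (simp add: mat_diag_mult_right[OF V] scalar_prod_def lessThan_atLeast0 mult.commute)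
qed

text \<open>These are the entries of the adjoint of \<open>V\<close> times \<open>A * V\<close>. The
  diagonal ones yield positivity of eigenvalues; the vanishing off-diagonal ones settle the rank one
  case.\<close>

lemma spectral_decomp_congruence:
  assumes "i < n" "j < n"
  shows "(\<Sum>k<n. \<Sum>l<n. cnj (V $$ (k, i)) * A $$ (k, l) * V $$ (l, j)) =
    (if i = j then complex_of_real (ev j) else 0)"
proof -
  have "(\<Sum>k<n. \<Sum>l<n. cnj (V $$ (k, i)) * A $$ (k, l) * V $$ (l, j)) =
    (\<Sum>k<n. cnj (V $$ (k, i)) * (\<Sum>l<n. A $$ (k, l) * V $$ (l, j)))"
    by (simp add: sum_distrib_left mult.assoc)
  also have "\<dots> = complex_of_real (ev j) * (\<Sum>k<n. cnj (V $$ (k, i)) * V $$ (k, j))"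
    using assms by (simp add: mat_mult_eigenvector sum_distrib_left mult.left_commute)
  also have "(\<Sum>k<n. cnj (V $$ (k, i)) * V $$ (k, j)) = (if i = j then 1 else 0)"
    using arg_cong[OF unitary_matD(1)[OF spectral_decomp_carrier(2,1)], of "\<lambda>M. M $$ (i, j)"]
      spectral_decomp_carrier(1) assms
    by (simp add: scalar_prod_def lessThan_atLeast0)
  finally show ?thesis by simp
qed

text \<open>The Gram form expresses positive semidefiniteness in the shape that a partial trace
  produces. Here \<open>ev j\<close> is the sum of the squared moduli of the components of the
  vectors \<open>F a\<close> along eigenvector \<open>j\<close>.\<close>

lemma spectral_decomp_gram_nonneg:
  assumes gram: "\<And>k l. k < n \<Longrightarrow> l < n \<Longrightarrow> A $$ (k, l) = (\<Sum>a\<in>S. F a k * cnj (F a l))"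
    and j: "j < n"
  shows "ev j \<ge> 0"
proof -
  define z where "z a = (\<Sum>k<n. cnj (V $$ (k, j)) * F a k)" for a
  have "complex_of_real (ev j) =
    (\<Sum>k<n. \<Sum>l<n. cnj (V $$ (k, j)) * (\<Sum>a\<in>S. F a k * cnj (F a l)) * V $$ (l, j))"
    using spectral_decomp_congruence[OF j j] gram by simp
  also have "\<dots> = (\<Sum>k<n. \<Sum>l<n. \<Sum>a\<in>S. (cnj (V $$ (k, j)) * F a k) * (cnj (F a l) * V $$ (l, j)))"
    by (simp add: sum_distrib_left sum_distrib_right mult_ac)
  also have "\<dots> = (\<Sum>k<n. \<Sum>a\<in>S. \<Sum>l<n. (cnj (V $$ (k, j)) * F a k) * (cnj (F a l) * V $$ (l, j)))"
    by (intro sum.cong refl sum.swap)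
  also have "\<dots> = (\<Sum>a\<in>S. \<Sum>k<n. \<Sum>l<n. (cnj (V $$ (k, j)) * F a k) * (cnj (F a l) * V $$ (l, j)))"
    by (rule sum.swap)
  also have "\<dots> = (\<Sum>a\<in>S. z a * cnj (z a))"
    unfolding z_def cnj_sum sum_product by (simp add: mult_ac)
  also have "\<dots> = complex_of_real (\<Sum>a\<in>S. (cmod (z a))\<^sup>2)"
    by (simp only: complex_norm_square of_real_sum)
  finally have "ev j = (\<Sum>a\<in>S. (cmod (z a))\<^sup>2)"
    by (simp only: of_real_eq_iff)
  then show ?thesis by (simp add: sum_nonneg)
qed

text \<open>The trace is \<open>c\<close> times the quadratic form of \<open>f(A)\<close> at \<psi>,
  evaluated in the eigenbasis of \<open>A\<close>.\<close>

lemma mat_trace_ket_bra_herm_fun: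
  assumes \<psi>: "\<psi> \<in> carrier_vec n"
  shows "mat_trace ((c \<cdot>\<^sub>m ket_bra \<psi> \<psi>) * herm_fun f A) =
    c * complex_of_real (\<Sum>j<n. f (ev j) * (cmod (\<Sum>k<n. cnj (V $$ (k, j)) * \<psi> $ k))\<^sup>2)"
proof -
  define \<beta> where "\<beta> j = (\<Sum>k<n. cnj (V $$ (k, j)) * \<psi> $ k)" for j
  have \<beta>\<beta>: "\<beta> j * cnj (\<beta> j) =
      (\<Sum>k<n. \<Sum>l<n. (cnj (V $$ (k, j)) * \<psi> $ k) * (V $$ (l, j) * cnj (\<psi> $ l)))" for j
    unfolding \<beta>_def cnj_sum sum_product by simp
  have "mat_trace ((c \<cdot>\<^sub>m ket_bra \<psi> \<psi>) * herm_fun f A) =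
    (\<Sum>k<n. \<Sum>l<n. c * (\<psi> $ k * cnj (\<psi> $ l)) * herm_fun f A $$ (l, k))"
    using \<psi> herm_fun_carrier[of f]
    by (auto simp: mat_trace_def ket_bra_def scalar_prod_def lessThan_atLeast0 intro!: sum.cong)
  also have "\<dots> = (\<Sum>k<n. \<Sum>l<n. \<Sum>j<n. c * (complex_of_real (f (ev j)) *
      ((cnj (V $$ (k, j)) * \<psi> $ k) * (V $$ (l, j) * cnj (\<psi> $ l)))))"
    by (simp add: index_herm_fun sum_distrib_left mult_ac)
  also have "\<dots> = (\<Sum>k<n. \<Sum>j<n. \<Sum>l<n. c * (complex_of_real (f (ev j)) *
      ((cnj (V $$ (k, j)) * \<psi> $ k) * (V $$ (l, j) * cnj (\<psi> $ l)))))"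
    by (intro sum.cong refl sum.swap)
  also have "\<dots> = (\<Sum>j<n. \<Sum>k<n. \<Sum>l<n. c * (complex_of_real (f (ev j)) *
      ((cnj (V $$ (k, j)) * \<psi> $ k) * (V $$ (l, j) * cnj (\<psi> $ l)))))"
    by (rule sum.swap)
  also have "\<dots> = c * (\<Sum>j<n. complex_of_real (f (ev j)) * (\<beta> j * cnj (\<beta> j)))"
    by (simp only: \<beta>\<beta> sum_distrib_left)
  also have "\<dots> = c * complex_of_real (\<Sum>j<n. f (ev j) * (cmod (\<beta> j))\<^sup>2)"
    by (simp only: complex_norm_square of_real_sum of_real_mult)
  finally show ?thesis by (simp add: \<beta>_def)
qed

text \<open>The vector \<psi> is orthogonal to the kernel of its own rank one operator, hence lies
  in the support of \<open>A\<close>, while an eigenvector with eigenvalue 0 lies in the kernel of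
  \<open>A\<close>.\<close>

lemma orthogonal_of_mat_supp_le:
  assumes \<psi>: "\<psi> \<in> carrier_vec n" and c: "c \<noteq> 0"
    and supp: "mat_supp (c \<cdot>\<^sub>m ket_bra \<psi> \<psi>) \<subseteq> mat_supp A"
    and j: "j < n" and ev: "ev j = 0"
  shows "(\<Sum>k<n. cnj (V $$ (k, j)) * \<psi> $ k) = 0"
proof -
  have "\<psi> \<bullet>c w = 0" if "w \<in> mat_kernel (c \<cdot>\<^sub>m ket_bra \<psi> \<psi>)" for w
  proof (cases "\<psi> = 0\<^sub>v n")
    case True
    then show ?thesis using that \<psi> by (auto simp: mat_kernel_def ket_bra_def)
  next
    case False
    \<comment> \<open>Coordinate \<open>k\<close> of the kernel equation carries the nonzero factor
      \<open>c * \<psi> $ k\<close>, which cancels and leaves the inner product.\<close>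
    then obtain k where k: "k < n" "\<psi> $ k \<noteq> 0"
      using \<psi> by (metis carrier_vecD eq_vecI index_zero_vec)
    have w: "w \<in> carrier_vec n" and "((c \<cdot>\<^sub>m ket_bra \<psi> \<psi>) *\<^sub>v w) $ k = 0"
      using that k \<psi> by (auto simp: mat_kernel_def ket_bra_def)
    then have "c * \<psi> $ k * (\<Sum>l<n. cnj (\<psi> $ l) * w $ l) = 0"
      using k \<psi>
      by (simp add: ket_bra_def scalar_prod_def lessThan_atLeast0 sum_distrib_left mult.assoc)
    then have "cnj (\<Sum>l<n. cnj (\<psi> $ l) * w $ l) = 0" using k c by simp
    then show ?thesis using w \<psi> by (simp add: scalar_prod_def lessThan_atLeast0 mult.commute)
  qed
  then have "\<psi> \<in> mat_supp A"
    using supp \<psi> by (auto simp: mat_supp_def ket_bra_def)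
  moreover have "col V j \<in> mat_kernel A"
    using A spectral_decomp_carrier(1) j ev mat_mult_eigenvector[of _ j]
    by (auto simp: mat_kernel_def scalar_prod_def lessThan_atLeast0 intro!: eq_vecI)
  ultimately have "\<psi> \<bullet>c col V j = 0" by (simp add: mat_supp_def)
  then show ?thesis
    using spectral_decomp_carrier(1) j by (simp add: scalar_prod_def lessThan_atLeast0 mult.commute)
qed

end

text \<open>In any eigenbasis of \<rho> the products \<open>\<beta> i * cnj (\<beta> j)\<close> with
  \<open>i \<noteq> j\<close> vanish up to the factor \<open>c\<close>. So at most one eigenvalue is
  nonzero, and it equals the trace \<open>r\<close>.\<close>

lemma mat_trace_rank_one_log:
  fixes c :: real
  assumes \<psi>: "\<psi> \<in> carrier_vec n"
  defines "\<rho> \<equiv> complex_of_real c \<cdot>\<^sub>m ket_bra \<psi> \<psi>" and "r \<equiv> c * (\<Sum>k<n. (cmod (\<psi> $ k))\<^sup>2)"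
  shows "mat_trace (\<rho> * mat_log \<rho>) = complex_of_real (if r = 0 then 0 else r * ln r)"
proof -
  have \<rho>: "\<rho> \<in> carrier_mat n n" using \<psi> by (simp add: \<rho>_def ket_bra_def)
  have "mat_adjoint \<rho> = \<rho>" using \<psi> by (intro eq_matI) (auto simp: \<rho>_def ket_bra_def)
  then obtain V ev where sd: "spectral_decomp \<rho> V ev"
    using hermitian_spectral_decomp[OF \<rho>] by auto
  define \<beta> where "\<beta> j = (\<Sum>k<n. cnj (V $$ (k, j)) * \<psi> $ k)" for j
  define f where "f x = (if x = 0 then 0 else ln x)" for x :: real
  have \<beta>\<beta>: "\<beta> i * cnj (\<beta> j) =
      (\<Sum>k<n. \<Sum>l<n. (cnj (V $$ (k, i)) * \<psi> $ k) * (V $$ (l, j) * cnj (\<psi> $ l)))" for i j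
    unfolding \<beta>_def cnj_sum sum_product by simp
  have ortho: "complex_of_real c * (\<beta> i * cnj (\<beta> j)) = (if i = j then complex_of_real (ev j) else 0)"
    if "i < n" "j < n" for i j
    unfolding spectral_decomp_congruence[OF \<rho> sd that, symmetric] \<beta>\<beta> sum_distrib_left
    using that \<psi> by (intro sum.cong refl) (simp add: \<rho>_def ket_bra_def mult_ac)
  have ev: "ev j = c * (cmod (\<beta> j))\<^sup>2" if "j < n" for j
    using ortho[OF that that, unfolded complex_norm_square[symmetric] of_real_mult[symmetric]]
    by (simp del: of_real_mult of_real_power)
  have sum_ev: "(\<Sum>j<n. ev j) = r"
    using parseval_norm_sum[where V = "\<lambda>k j. V $$ (k, j)", OF spectral_decomp_rows[OF \<rho> sd], where x = "\<lambda>k. \<psi> $ k"]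
    by (simp add: ev r_def \<beta>_def flip: sum_distrib_left)
  \<comment> \<open>The factor \<open>ev j\<close> makes this trivial for eigenvalue 0; a nonzero
    \<open>ev j\<close> forces all others to vanish and so equals \<open>r\<close>.\<close>
  have term_eq: "ev j * f (ev j) = ev j * f r" if j: "j < n" for j
  proof (cases "ev j = 0")
    case False
    then have "ev i = 0" if "i < n" "i \<noteq> j" for i
      using ortho[OF that(1) j] ev[OF j] ev[OF that(1)] that(2) by auto
    then have "(\<Sum>j<n. ev j) = ev j" using j by (subst sum.remove[of _ j]) auto
    then show ?thesis using sum_ev by simp
  qed simp
  have "mat_trace (\<rho> * mat_log \<rho>) =
      complex_of_real c * complex_of_real (\<Sum>j<n. f (ev j) * (cmod (\<beta> j))\<^sup>2)"
    using mat_trace_ket_bra_herm_fun[OF \<rho> sd \<psi>, of "complex_of_real c" f]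
    unfolding \<rho>_def \<beta>_def mat_log_def f_def .
  also have "\<dots> = complex_of_real (\<Sum>j<n. ev j * f (ev j))"
    by (simp add: ev sum_distrib_left mult_ac flip: of_real_mult)
  also have "(\<Sum>j<n. ev j * f (ev j)) = r * f r"
    by (simp add: term_eq sum_ev flip: sum_distrib_right)
  finally show ?thesis by (simp add: f_def)
qed

text \<open>Dividing the diagonal of \<sigma> by \<open>c\<close> accounts for the prefactor, since
  \<open>c * t * ln (t / (q / c))\<close> is \<open>(c * t) * ln (c * t / q)\<close>. If the
  supports are not nested the left side is infinite; otherwise
  \<open>spectral_log_le_diagonal_log\<close> bounds the trace with
  \<open>log \<sigma>\<close>.\<close>

theorem rel_entropy_rank_one_ge_measured:
  assumes \<psi>: "\<psi> \<in> carrier_vec n" and c: "c > 0" and \<sigma>: "\<sigma> \<in> carrier_mat n n"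
    and gram: "\<And>k l. k < n \<Longrightarrow> l < n \<Longrightarrow> \<sigma> $$ (k, l) = (\<Sum>a\<in>S. F a k * cnj (F a l))"
  shows "rel_entropy (complex_of_real c \<cdot>\<^sub>m ket_bra \<psi> \<psi>) \<sigma> \<ge>
    ereal c * (\<Sum>k<n. log_ratio_term ((cmod (\<psi> $ k))\<^sup>2) (Re (\<sigma> $$ (k, k)) / c))"
proof (cases "mat_supp (complex_of_real c \<cdot>\<^sub>m ket_bra \<psi> \<psi>) \<subseteq> mat_supp \<sigma>")
  case False
  then show ?thesis by (simp add: rel_entropy_def)
next
  case True
  let ?\<rho> = "complex_of_real c \<cdot>\<^sub>m ket_bra \<psi> \<psi>"
  have "mat_adjoint \<sigma> = \<sigma>"
    using \<sigma> by (intro eq_matI) (auto simp: gram mult.commute)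
  then obtain V ev where sd: "spectral_decomp \<sigma> V ev"
    using hermitian_spectral_decomp[OF \<sigma>] by auto
  note V = spectral_decomp_rows[OF \<sigma> sd]
  have ev: "ev j \<ge> 0" if "j < n" for j
    using spectral_decomp_gram_nonneg[OF \<sigma> sd gram that] .
  define \<beta> where "\<beta> j = (\<Sum>k<n. cnj (V $$ (k, j)) * \<psi> $ k)" for j
  define p where "p k = (cmod (\<psi> $ k))\<^sup>2" for k
  define q where "q k = (\<Sum>j<n. ev j * (cmod (V $$ (k, j)))\<^sup>2)" for k
  define P where "P = (\<Sum>k<n. p k)"
  let ?K = "{k. k < n \<and> p k > 0}"
  have q: "Re (\<sigma> $$ (k, k)) = q k" if "k < n" for k
    using spectral_decomp_diagonal_entry[OF \<sigma> sd that] by (simp add: q_def)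
  have q_nonneg: "q k \<ge> 0" for k using ev by (auto simp: q_def intro!: sum_nonneg)
  have supp: "\<beta> j = 0" if "j < n" "ev j = 0" for j
    using orthogonal_of_mat_supp_le[OF \<sigma> sd \<psi> _ True that] c by (simp add: \<beta>_def)
  \<comment> \<open>Nested supports exclude infinite summands: a zero diagonal entry of \<sigma>
    would force the same coordinate of \<psi> to vanish.\<close>
  have q_pos: "q k > 0" if "k \<in> ?K" for k
  proof -
    have "q k \<noteq> 0"
    proof
      assume "q k = 0"
      with V ev supp that have "\<psi> $ k = 0" unfolding \<beta>_def q_def
        by (intro spectral_diagonal_zero_imp_zero[where V = "\<lambda>k j. V $$ (k, j)" and n = n and ev = ev
              and \<psi> = "\<lambda>k. \<psi> $ k" and k = k]) auto
      then show False using that by (simp add: p_def)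
    qed
    then show ?thesis using q_nonneg[of k] by simp
  qed
  have PK: "P = sum p ?K"
    unfolding P_def by (rule sum.mono_neutral_right) (auto simp: p_def)
  have "(\<Sum>k<n. log_ratio_term (p k) (Re (\<sigma> $$ (k, k)) / c))
      = (\<Sum>k<n. ereal (if p k > 0 then p k * ln (p k / (q k / c)) else 0))"
    using q_pos c by (intro sum.cong refl) (force simp: log_ratio_term_def q p_def)
  also have "\<dots> = ereal (\<Sum>k\<in>?K. p k * ln (p k / (q k / c)))"
    unfolding sum_ereal ereal.inject by (rule sum.mono_neutral_cong_right) auto
  finally have rhs: "ereal c * (\<Sum>k<n. log_ratio_term ((cmod (\<psi> $ k))\<^sup>2) (Re (\<sigma> $$ (k, k)) / c))
      = ereal (c * (\<Sum>k\<in>?K. p k * ln (p k / (q k / c))))"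
    by (simp add: p_def)
  have tr_\<rho>: "Re (mat_trace (?\<rho> * mat_log ?\<rho>)) = (if c * P = 0 then 0 else c * P * ln (c * P))"
    using mat_trace_rank_one_log[OF \<psi>, of c] by (simp add: P_def p_def)
  have "Re (mat_trace (?\<rho> * mat_log \<sigma>)) =
      c * (\<Sum>j<n. (if ev j = 0 then 0 else ln (ev j)) * (cmod (\<beta> j))\<^sup>2)"
    unfolding mat_log_def mat_trace_ket_bra_herm_fun[OF \<sigma> sd \<psi>] \<beta>_def
    by (simp flip: of_real_mult)
  also have "(\<Sum>j<n. (if ev j = 0 then 0 else ln (ev j)) * (cmod (\<beta> j))\<^sup>2)
      = (\<Sum>j | j < n \<and> ev j > 0. (cmod (\<beta> j))\<^sup>2 * ln (ev j))"
    using ev by (intro sum.mono_neutral_cong_right) (force simp: less_le)+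
  also have "\<dots> \<le> (\<Sum>k\<in>?K. p k * ln (P * q k / p k))"
    using V ev supp unfolding \<beta>_def p_def q_def P_def
    by (rule spectral_log_le_diagonal_log[where V = "\<lambda>k j. V $$ (k, j)" and \<psi> = "\<lambda>k. \<psi> $ k"])
  finally have tr_\<sigma>: "Re (mat_trace (?\<rho> * mat_log \<sigma>)) \<le> c * (\<Sum>k\<in>?K. p k * ln (P * q k / p k))"
    using c by simp
  \<comment> \<open>Weighted by \<open>c * p k\<close> and summed, the first logarithm gives the
    trace of \<open>\<rho> log \<rho>\<close>, and the second is controlled by
    \<open>tr_\<sigma>\<close>.\<close>
  have split: "ln (p k / (q k / c)) = ln (c * P) - ln (P * q k / p k)" if k: "k \<in> ?K" for k
  proof -
    have "P > 0" unfolding PK using k by (intro sum_pos) auto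
    then show ?thesis using k q_pos[OF k] c by (simp add: ln_mult ln_div)
  qed
  have "(\<Sum>k\<in>?K. p k * ln (p k / (q k / c)))
      = (\<Sum>k\<in>?K. p k * ln (c * P)) - (\<Sum>k\<in>?K. p k * ln (P * q k / p k))"
    unfolding sum_subtractf[symmetric]
    by (intro sum.cong refl) (simp only: split right_diff_distrib)
  also have "(\<Sum>k\<in>?K. p k * ln (c * P)) = P * ln (c * P)"
    by (simp only: sum_distrib_right[symmetric] PK[symmetric])
  finally have "c * (\<Sum>k\<in>?K. p k * ln (p k / (q k / c)))
      = c * P * ln (c * P) - c * (\<Sum>k\<in>?K. p k * ln (P * q k / p k))"
    by (simp only: right_diff_distrib mult.assoc)
  also have "\<dots> \<le> Re (mat_trace (?\<rho> * mat_log ?\<rho>) - mat_trace (?\<rho> * mat_log \<sigma>))"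
    using tr_\<rho> tr_\<sigma> by (auto split: if_splits)
  finally show ?thesis
    unfolding rhs rel_entropy_def using True by simp
qed

subsection \<open>Coordinates in the product basis\<close>

text \<open>The first label is the most significant digit, because \<open>tensor_vec\<close> places
  the labels \<open>(a, r)\<close> at position \<open>a * q + r\<close>.\<close>

primrec digits_value :: "nat \<Rightarrow> nat list \<Rightarrow> nat" where
  "digits_value n [] = 0"
| "digits_value n (a # as) = a * n ^ length as + digits_value n as"

definition seq_pos :: "nat \<Rightarrow> nat \<Rightarrow> (nat \<Rightarrow> nat) \<Rightarrow> nat" where
  "seq_pos n N x = digits_value n (map x [1..<Suc N])"

lemma mult_add_less:
  fixes a b p q :: nat
  assumes "a < p" "b < q"
  shows "a * q + b < p * q"
proof -
  have "a * q + b < Suc a * q" using assms by simp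
  also have "\<dots> \<le> p * q" using assms by (intro mult_le_mono1) simp
  finally show ?thesis .
qed

lemma mult_add_eq_iff:
  fixes a b a' b' q :: nat
  assumes "b < q" "b' < q"
  shows "a * q + b = a' * q + b' \<longleftrightarrow> a = a' \<and> b = b'"
proof
  assume eq: "a * q + b = a' * q + b'"
  have "(a * q + b) div q = a" "(a' * q + b') div q = a'" using assms by simp_all
  with eq show "a = a' \<and> b = b'" by simp
qed simp

lemma digits_value_less: "set as \<subseteq> {..<n} \<Longrightarrow> digits_value n as < n ^ length as"
  by (induction as) (auto intro: mult_add_less)

lemma digits_value_inj:
  assumes "length as = length bs" "set as \<subseteq> {..<n}" "set bs \<subseteq> {..<n}"
    and "digits_value n as = digits_value n bs"
  shows "as = bs"
  using assms
proof (induction as bs rule: list_induct2)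
  case (Cons a as b bs)
  let ?q = "n ^ length bs"
  have r: "digits_value n as < ?q" "digits_value n bs < ?q"
    using Cons digits_value_less[of as n] digits_value_less[of bs n] by auto
  have eq: "a * ?q + digits_value n as = b * ?q + digits_value n bs"
    using Cons by simp
  then show ?case using Cons mult_add_eq_iff[OF r] by simp
qed simp

lemma tensor_unit_vec:
  assumes "a < p" "b < q"
  shows "unit_vec p a \<otimes>\<^sub>v unit_vec q b = unit_vec (p * q) (a * q + b)"
proof (rule eq_vecI)
  fix i assume "i < dim_vec (unit_vec (p * q) (a * q + b) :: complex vec)"
  then have i: "i < p * q" by simp
  then have "i div q < p" "i mod q < q" using assms by (auto simp: less_mult_imp_div_less)
  then have "i = a * q + b \<longleftrightarrow> i div q = a \<and> i mod q = b"
    using mult_add_eq_iff[of "i mod q" q b "i div q" a] assms \<open>i mod q < q\<close> by simp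
  with \<open>i div q < p\<close> \<open>i mod q < q\<close> show "(unit_vec p a \<otimes>\<^sub>v unit_vec q b) $ i = unit_vec (p * q) (a * q + b) $ i"
    using i assms by (auto simp: tensor_vec_def unit_vec_def)
qed (simp add: tensor_vec_def)

lemma label_seqs_less: "x \<in> label_seqs n N \<Longrightarrow> 1 \<le> l \<Longrightarrow> l \<le> N \<Longrightarrow> x l < n"
  by (auto simp: label_seqs_def)

lemma label_seqs_digits: "x \<in> label_seqs n N \<Longrightarrow> set (map x [1..<Suc N]) \<subseteq> {..<n}"
  by (auto dest: label_seqs_less)

lemma finite_label_seqs: "finite (label_seqs n N)"
  by (simp add: label_seqs_def finite_PiE)

lemma seq_pos_less: "x \<in> label_seqs n N \<Longrightarrow> seq_pos n N x < n ^ N"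
  using digits_value_less[OF label_seqs_digits] by (fastforce simp: seq_pos_def)

text \<open>Uniqueness of base \<open>n\<close> digits gives injectivity, extensionality of label
  sequences being what turns agreement on \<open>{1..N}\<close> into equality. Both sets have
  \<open>n ^ N\<close> elements.\<close>

lemma bij_betw_seq_pos: "bij_betw (seq_pos n N) (label_seqs n N) {..<n ^ N}"
proof -
  have inj: "inj_on (seq_pos n N) (label_seqs n N)"
  proof (rule inj_onI)
    fix x y assume x: "x \<in> label_seqs n N" and y: "y \<in> label_seqs n N"
      and "seq_pos n N x = seq_pos n N y"
    then have "map x [1..<Suc N] = map y [1..<Suc N]"
      unfolding seq_pos_def by (intro digits_value_inj label_seqs_digits) auto
    then have "x l = y l" if "l \<in> {1..N}" for l using that by (auto simp del: upt_Suc)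
    then show "x = y" using x y unfolding label_seqs_def by (intro PiE_ext) auto
  qed
  moreover have "seq_pos n N ` label_seqs n N = {..<n ^ N}"
  proof (rule card_subset_eq)
    show "card (seq_pos n N ` label_seqs n N) = card {..<n ^ N}"
      using inj by (simp add: card_image) (simp add: label_seqs_def card_PiE)
  qed (auto intro: seq_pos_less)
  ultimately show ?thesis by (simp add: bij_betw_def)
qed

lemma seq_pos_eq_iff:
  "x \<in> label_seqs n N \<Longrightarrow> y \<in> label_seqs n N \<Longrightarrow> seq_pos n N x = seq_pos n N y \<longleftrightarrow> x = y"
  using bij_betw_seq_pos[of n N] by (auto simp: bij_betw_def inj_on_eq_iff)

lemma foldr_tensor_unit_vec:
  "set as \<subseteq> {..<n} \<Longrightarrow>
    foldr (\<otimes>\<^sub>v) (map (unit_vec n) as) (unit_vec 1 0) = unit_vec (n ^ length as) (digits_value n as)"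
  by (induction as) (auto simp: tensor_unit_vec digits_value_less)

lemma basis_ket_eq:
  assumes "x \<in> label_seqs n N"
  shows "basis_ket n N x = unit_vec (n ^ N) (seq_pos n N x)"
  using foldr_tensor_unit_vec[OF label_seqs_digits[OF assms]]
  by (simp add: basis_ket_def seq_pos_def comp_def del: upt_Suc)

section \<open>Coordinates of the matrix product state\<close>

lemma mps_vec_carrier: "mps_vec m d A N \<in> carrier_vec (d ^ N)"
  unfolding mps_vec_def by (rule finsum_vec_closed) (auto simp: basis_ket_eq)

lemma mps_vec_index:
  assumes k: "k \<in> label_seqs d N"
  shows "mps_vec m d A N $ seq_pos d N k = mps_coeff m A N k"
proof -
  have "mps_vec m d A N $ seq_pos d N k =
    (\<Sum>x\<in>label_seqs d N. mps_coeff m A N x * unit_vec (d ^ N) (seq_pos d N x) $ seq_pos d N k)"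
    unfolding mps_vec_def using seq_pos_less[OF k]
    by (subst index_finsum_vec) (auto simp: finite_label_seqs basis_ket_eq)
  also have "\<dots> = (\<Sum>x\<in>label_seqs d N. if x = k then mps_coeff m A N x else 0)"
    using k seq_pos_less by (intro sum.cong refl) (auto simp: unit_vec_def seq_pos_eq_iff)
  also have "\<dots> = mps_coeff m A N k" using k by (simp add: finite_label_seqs)
  finally show ?thesis .
qed

section \<open>Coordinates of the hidden Markov state and its observation density\<close>

definition ehmm_amplitude ::
  "(nat \<Rightarrow> real) \<Rightarrow> (nat \<Rightarrow> complex mat) \<Rightarrow> (nat \<Rightarrow> complex mat) \<Rightarrow> nat \<Rightarrow> (nat \<Rightarrow> nat) \<Rightarrow> (nat \<Rightarrow> nat) \<Rightarrow> complex"
  where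
  "ehmm_amplitude \<pi> U \<chi> N i k = complex_of_real (sqrt (\<pi> (i 1))) *
     (\<Prod>l = 1..N. U l $$ (i l, i (l + 1)) * \<chi> l $$ (i l, k l))"

lemma ehmm_basis_ket:
  assumes "i \<in> label_seqs m (Suc N)" "k \<in> label_seqs d N"
  shows "basis_ket m (Suc N) i \<otimes>\<^sub>v basis_ket d N k =
    unit_vec (m ^ Suc N * d ^ N) (seq_pos m (Suc N) i * d ^ N + seq_pos d N k)"
  using assms by (simp only: basis_ket_eq tensor_unit_vec seq_pos_less)

lemma ehmm_state_eq:
  "ehmm_state m d \<pi> U \<chi> N = finsum_vec TYPE(complex) (m ^ Suc N * d ^ N)
     (\<lambda>(i, k). ehmm_amplitude \<pi> U \<chi> N i k \<cdot>\<^sub>v (basis_ket m (Suc N) i \<otimes>\<^sub>v basis_ket d N k))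
     (label_seqs m (Suc N) \<times> label_seqs d N)"
  by (simp only: ehmm_state_def ehmm_amplitude_def Suc_eq_plus1)

lemma ehmm_state_carrier: "ehmm_state m d \<pi> U \<chi> N \<in> carrier_vec (m ^ Suc N * d ^ N)"
  unfolding ehmm_state_eq
  by (rule finsum_vec_closed) (auto simp: ehmm_basis_ket simp del: power_Suc)

text \<open>Distinct pairs of label sequences occupy distinct positions, so a single term of the sum
  survives.\<close>

lemma ehmm_state_index:
  assumes i: "i \<in> label_seqs m (Suc N)" and k: "k \<in> label_seqs d N"
  shows "ehmm_state m d \<pi> U \<chi> N $ (seq_pos m (Suc N) i * d ^ N + seq_pos d N k) =
    ehmm_amplitude \<pi> U \<chi> N i k"
proof -
  let ?S = "label_seqs m (Suc N) \<times> label_seqs d N" and ?D = "m ^ Suc N * d ^ N"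
  define pos where "pos = (\<lambda>(i, k). seq_pos m (Suc N) i * d ^ N + seq_pos d N k)"
  have pos_less: "pos z < ?D" if "z \<in> ?S" for z
    using that by (cases z) (auto simp only: pos_def prod.case mem_Sigma_iff intro!: mult_add_less seq_pos_less)
  have pos_eq: "pos z = pos z' \<longleftrightarrow> z = z'" if z: "z \<in> ?S" "z' \<in> ?S" for z z'
  proof
    assume eq: "pos z = pos z'"
    obtain a b a' b' where ab: "z = (a, b)" "z' = (a', b')" by (cases z, cases z')
    then have mem: "a \<in> label_seqs m (Suc N)" "a' \<in> label_seqs m (Suc N)"
      "b \<in> label_seqs d N" "b' \<in> label_seqs d N" using z by auto
    note less = seq_pos_less[OF mem(3)] seq_pos_less[OF mem(4)]
    have "seq_pos m (Suc N) a = seq_pos m (Suc N) a' \<and> seq_pos d N b = seq_pos d N b'"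
      using eq mult_add_eq_iff[OF less] by (simp add: pos_def ab)
    then show "z = z'" using mem by (simp add: ab seq_pos_eq_iff)
  qed simp
  have ik: "(i, k) \<in> ?S" using i k by simp
  have "ehmm_state m d \<pi> U \<chi> N $ pos (i, k) =
    (\<Sum>z\<in>?S. (case z of (i, k) \<Rightarrow> ehmm_amplitude \<pi> U \<chi> N i k \<cdot>\<^sub>v
      (basis_ket m (Suc N) i \<otimes>\<^sub>v basis_ket d N k)) $ pos (i, k))"
    unfolding ehmm_state_eq
    by (rule index_finsum_vec)
       (use pos_less[OF ik] in \<open>auto simp: finite_label_seqs ehmm_basis_ket
          simp del: power_Suc\<close>)
  also have "\<dots> = (\<Sum>z\<in>?S. if z = (i, k) then ehmm_amplitude \<pi> U \<chi> N i k else 0)"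
  proof (rule sum.cong[OF refl])
    fix z assume z: "z \<in> ?S"
    obtain a b where ab: "z = (a, b)" by (cases z)
    have "(ehmm_amplitude \<pi> U \<chi> N a b \<cdot>\<^sub>v unit_vec ?D (pos (a, b))) $ pos (i, k) =
      (if pos z = pos (i, k) then ehmm_amplitude \<pi> U \<chi> N a b else 0)"
      using pos_less[OF ik] pos_less[OF z] by (simp add: unit_vec_def ab)
    then show "(case z of (i, k) \<Rightarrow> ehmm_amplitude \<pi> U \<chi> N i k \<cdot>\<^sub>v
      (basis_ket m (Suc N) i \<otimes>\<^sub>v basis_ket d N k)) $ pos (i, k) =
      (if z = (i, k) then ehmm_amplitude \<pi> U \<chi> N i k else 0)"
      using z pos_eq[OF z ik] by (auto simp: ab ehmm_basis_ket pos_def)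
  qed
  also have "\<dots> = ehmm_amplitude \<pi> U \<chi> N i k"
    using ik finite_cartesian_product[OF finite_label_seqs finite_label_seqs, of m "Suc N" d N]
    by simp
  finally show ?thesis by (simp add: pos_def)
qed

lemma ehmm_obs_density_carrier: "ehmm_obs_density m d \<pi> U \<chi> N \<in> carrier_mat (d ^ N) (d ^ N)"
  by (simp add: ehmm_obs_density_def ptrace_fst_def)

text \<open>This is the Gram form that \<open>rel_entropy_rank_one_ge_measured\<close> asks of
  \<sigma>.\<close>

lemma ehmm_obs_density_index:
  assumes "r < d ^ N" "s < d ^ N"
  shows "ehmm_obs_density m d \<pi> U \<chi> N $$ (r, s) =
    (\<Sum>a<m ^ Suc N. ehmm_state m d \<pi> U \<chi> N $ (a * d ^ N + r) *
      cnj (ehmm_state m d \<pi> U \<chi> N $ (a * d ^ N + s)))"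
proof -
  have "ket_bra v v $$ (a * d ^ N + r, a * d ^ N + s) = v $ (a * d ^ N + r) * cnj (v $ (a * d ^ N + s))"
    if "a < m ^ Suc N" "v \<in> carrier_vec (m ^ Suc N * d ^ N)" for a v
    using that assms mult_add_less[of a "m ^ Suc N" _ "d ^ N"] by (simp add: ket_bra_def)
  then show ?thesis
    using assms ehmm_state_carrier unfolding ehmm_obs_density_def ptrace_fst_def Suc_eq_plus1[symmetric]
    by (simp del: power_Suc)
qed

text \<open>On the diagonal the Gram terms are squared moduli, and \<open>seq_pos\<close> reindexes
  the traced-out positions by hidden sequences.\<close>

lemma ehmm_obs_density_diagonal:
  assumes k: "k \<in> label_seqs d N"
  shows "Re (ehmm_obs_density m d \<pi> U \<chi> N $$ (seq_pos d N k, seq_pos d N k)) =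
    (\<Sum>i\<in>label_seqs m (Suc N). (cmod (ehmm_amplitude \<pi> U \<chi> N i k))\<^sup>2)"
proof -
  have "Re (ehmm_obs_density m d \<pi> U \<chi> N $$ (seq_pos d N k, seq_pos d N k)) =
    (\<Sum>a<m ^ Suc N. (cmod (ehmm_state m d \<pi> U \<chi> N $ (a * d ^ N + seq_pos d N k)))\<^sup>2)"
    using k by (simp only: ehmm_obs_density_index seq_pos_less complex_norm_square[symmetric]
        of_real_sum[symmetric] Re_complex_of_real)
  also have "\<dots> = (\<Sum>i\<in>label_seqs m (Suc N).
    (cmod (ehmm_state m d \<pi> U \<chi> N $ (seq_pos m (Suc N) i * d ^ N + seq_pos d N k)))\<^sup>2)"
    by (rule sum.reindex_bij_betw[OF bij_betw_seq_pos, symmetric])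
  also have "\<dots> = (\<Sum>i\<in>label_seqs m (Suc N). (cmod (ehmm_amplitude \<pi> U \<chi> N i k))\<^sup>2)"
    using k by (intro sum.cong refl) (simp only: ehmm_state_index)
  finally show ?thesis .
qed

section \<open>Matrix products as sums over paths\<close>

lemma label_seqs_0: "label_seqs n 0 = {\<lambda>_. undefined}"
  by (simp add: label_seqs_def)

text \<open>The last label is split off to match \<open>mat_seq_prod_Suc\<close>, where the product
  grows on the right.\<close>

lemma sum_label_seqs_Suc:
  "(\<Sum>x\<in>label_seqs n (Suc N). F x) = (\<Sum>x\<in>label_seqs n N. \<Sum>j<n. F (x(Suc N := j)))"
proof -
  have "label_seqs n (Suc N) = (\<lambda>(j, x). x(Suc N := j)) ` ({..<n} \<times> label_seqs n N)"
    by (simp add: label_seqs_def PiE_insert_eq atLeastAtMostSuc_conv lessThan_atLeast0)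
  moreover have "inj_on (\<lambda>(j, x). x(Suc N := j)) ({..<n} \<times> label_seqs n N)"
    using inj_combinator[of "Suc N" "{1..N}" "\<lambda>_. {..<n}"]
    by (simp add: label_seqs_def lessThan_atLeast0)
  ultimately have "(\<Sum>x\<in>label_seqs n (Suc N). F x) =
    (\<Sum>(j, x)\<in>{..<n} \<times> label_seqs n N. F (x(Suc N := j)))"
    by (simp add: sum.reindex comp_def case_prod_unfold)
  also have "\<dots> = (\<Sum>x\<in>label_seqs n N. \<Sum>j<n. F (x(Suc N := j)))"
    by (subst sum.swap) (simp add: sum.cartesian_product)
  finally show ?thesis .
qed

text \<open>The right fold ends in the identity; a general seed \<open>X\<close> allows the last
  matrix of a product to be pulled out.\<close>

lemma foldr_mult_mat:
  fixes X :: "complex mat"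
  assumes "set Bs \<subseteq> carrier_mat n n" "X \<in> carrier_mat n n"
  shows "foldr (*) Bs X \<in> carrier_mat n n \<and> foldr (*) Bs X = foldr (*) Bs (1\<^sub>m n) * X"
  using assms
proof (induction Bs)
  case (Cons B Bs)
  have "foldr (*) Bs (1\<^sub>m n) \<in> carrier_mat n n"
  proof -
    have "foldr (*) Bs Y \<in> carrier_mat n n" if "Y \<in> carrier_mat n n" for Y :: "complex mat"
      using Cons.prems(1) that by (induction Bs) auto
    then show ?thesis by simp
  qed
  then show ?case using Cons assoc_mult_mat[of B n n _ n X n] by auto
qed simp

lemma mat_seq_prod_carrier:
  "(\<And>l. B l \<in> carrier_mat n n) \<Longrightarrow> mat_seq_prod n N B \<in> carrier_mat n n"
  unfolding mat_seq_prod_def using foldr_mult_mat[of "map B [1..<Suc N]" n "1\<^sub>m n"] by (auto simp del: upt_Suc)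

lemma mat_seq_prod_Suc:
  assumes "\<And>l. B l \<in> carrier_mat n n"
  shows "mat_seq_prod n (Suc N) B = mat_seq_prod n N B * B (Suc N)"
proof -
  have "[1..<Suc (Suc N)] = [1..<Suc N] @ [Suc N]" by simp
  then show ?thesis
    using foldr_mult_mat[of "map B [1..<Suc N]" n "B (Suc N)"] assms right_mult_one_mat[OF assms]
    unfolding mat_seq_prod_def by (auto simp del: upt_Suc)
qed

text \<open>Boundary weights \<open>w\<close> and \<open>g\<close> sit at the two ends of the path.
  The induction varies \<open>g\<close>, because summing over the last label replaces
  \<open>g\<close> by its image \<open>?h\<close> under the last matrix.\<close>

lemma mat_seq_prod_path_sum:
  assumes B: "\<And>l. B l \<in> carrier_mat m m"
  shows "(\<Sum>x\<in>label_seqs m (Suc N). w (x 1) * (\<Prod>l = 1..N. B l $$ (x l, x (l + 1))) * g (x (Suc N)))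
    = (\<Sum>a<m. \<Sum>j<m. w a * mat_seq_prod m N B $$ (a, j) * g j)"
proof (induction N arbitrary: g)
  case 0
  have "(\<Sum>a<m. \<Sum>j<m. w a * mat_seq_prod m 0 B $$ (a, j) * g j) =
    (\<Sum>a<m. \<Sum>j<m. if a = j then w a * g a else 0)"
    by (intro sum.cong refl) (auto simp: mat_seq_prod_def)
  then show ?case by (simp add: sum_label_seqs_Suc label_seqs_0)
next
  case (Suc N)
  let ?M = "mat_seq_prod m N B" and ?h = "\<lambda>i. \<Sum>j<m. B (Suc N) $$ (i, j) * g j"
  have "(\<Sum>x\<in>label_seqs m (Suc (Suc N)).
      w (x 1) * (\<Prod>l = 1..Suc N. B l $$ (x l, x (l + 1))) * g (x (Suc (Suc N))))
    = (\<Sum>x\<in>label_seqs m (Suc N). w (x 1) * (\<Prod>l = 1..N. B l $$ (x l, x (l + 1))) * ?h (x (Suc N)))"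
    unfolding sum_label_seqs_Suc[of _ m "Suc N"]
    by (intro sum.cong refl) (simp add: sum_distrib_left mult.assoc)
  also have "\<dots> = (\<Sum>a<m. \<Sum>i<m. w a * ?M $$ (a, i) * ?h i)"
    by (rule Suc.IH)
  also have "\<dots> = (\<Sum>a<m. \<Sum>i<m. \<Sum>j<m. w a * (?M $$ (a, i) * B (Suc N) $$ (i, j)) * g j)"
    by (simp add: sum_distrib_left mult.assoc)
  also have "\<dots> = (\<Sum>a<m. \<Sum>j<m. \<Sum>i<m. w a * (?M $$ (a, i) * B (Suc N) $$ (i, j)) * g j)"
    by (intro sum.cong refl sum.swap)
  also have "\<dots> = (\<Sum>a<m. \<Sum>j<m. w a * (?M * B (Suc N)) $$ (a, j) * g j)"
    using mat_seq_prod_carrier[of B m N, OF B] B[of "Suc N"]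
    by (intro sum.cong refl)
       (simp add: scalar_prod_def lessThan_atLeast0 sum_distrib_left sum_distrib_right)
  finally show ?case by (simp only: mat_seq_prod_Suc[OF B])
qed

text \<open>The squared modulus of an amplitude is \<open>\<pi> (x 1)\<close> times a product of
  entries of the Schur squares, so the path formula applies with final weight 1. The vector
  \<open>uniform_vec\<close> has entries \<open>1 / sqrt m\<close> instead, whence the factor
  \<open>sqrt m\<close>.\<close>

lemma classical_weight_eq:
  assumes pi_nonneg: "\<And>i. i < m \<Longrightarrow> \<pi> i \<ge> 0"
  shows "(\<Sum>i\<in>label_seqs m (Suc N). (cmod (ehmm_amplitude \<pi> U \<chi> N i k))\<^sup>2) =
    sqrt (real m) * classical_weight m \<pi> (ehmm_mat m U \<chi>) N k"
\<comment> \<open>Cancelling \<open>sqrt m\<close> requires \<open>m > 0\<close>; for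
  \<open>m = 0\<close> there are no hidden sequences and both sides are 0.\<close>
proof (cases "m = 0")
  case True
  then show ?thesis by (simp add: sum_label_seqs_Suc)
next
  case False
  define B where "B l = schur_abs_sq (ehmm_mat m U \<chi> l (k l))" for l
  have B: "B l \<in> carrier_mat m m" for l
    by (simp add: B_def schur_abs_sq_def schur_prod_def ehmm_mat_def)
  have Bij: "B l $$ (i, j) = complex_of_real ((cmod (U l $$ (i, j) * \<chi> l $$ (i, k l)))\<^sup>2)"
    if "i < m" "j < m" for l i j
    unfolding complex_norm_square using that
    by (simp add: B_def schur_abs_sq_def schur_prod_def ehmm_mat_def)
  let ?M = "mat_seq_prod m N B"
  note M = mat_seq_prod_carrier[of B m N, OF B]
  have "complex_of_real (\<Sum>i\<in>label_seqs m (Suc N). (cmod (ehmm_amplitude \<pi> U \<chi> N i k))\<^sup>2) =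
    (\<Sum>x\<in>label_seqs m (Suc N). complex_of_real (\<pi> (x 1)) * (\<Prod>l = 1..N. B l $$ (x l, x (l + 1))) * 1)"
    unfolding of_real_sum
  proof (intro sum.cong refl)
    fix x assume x: "x \<in> label_seqs m (Suc N)"
    have "(\<Prod>l = 1..N. B l $$ (x l, x (l + 1))) =
      (\<Prod>l = 1..N. complex_of_real ((cmod (U l $$ (x l, x (l + 1)) * \<chi> l $$ (x l, k l)))\<^sup>2))"
      using label_seqs_less[OF x] by (intro prod.cong refl Bij) auto
    moreover have "(cmod (ehmm_amplitude \<pi> U \<chi> N x k))\<^sup>2 =
      \<pi> (x 1) * (\<Prod>l = 1..N. (cmod (U l $$ (x l, x (l + 1)) * \<chi> l $$ (x l, k l)))\<^sup>2)"
      unfolding ehmm_amplitude_def norm_mult power_mult_distrib prod_norm[symmetric] prod_power_distrib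
      using pi_nonneg[OF label_seqs_less[OF x, of 1]] by simp
    ultimately show "complex_of_real ((cmod (ehmm_amplitude \<pi> U \<chi> N x k))\<^sup>2) =
      complex_of_real (\<pi> (x 1)) * (\<Prod>l = 1..N. B l $$ (x l, x (l + 1))) * 1"
      by (simp only: of_real_mult of_real_prod mult_1_right)
  qed
  also have "\<dots> = (\<Sum>a<m. \<Sum>j<m. complex_of_real (\<pi> a) * ?M $$ (a, j) * 1)"
    by (rule mat_seq_prod_path_sum[OF B])
  finally have "(\<Sum>i\<in>label_seqs m (Suc N). (cmod (ehmm_amplitude \<pi> U \<chi> N i k))\<^sup>2) =
    Re (\<Sum>a<m. \<Sum>j<m. complex_of_real (\<pi> a) * ?M $$ (a, j))"
    by (metis (no_types, lifting) Re_complex_of_real mult_1_right sum.cong)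
  also have "\<dots> = sqrt (real m) * classical_weight m \<pi> (ehmm_mat m U \<chi>) N k"
  proof -
    have "classical_weight m \<pi> (ehmm_mat m U \<chi>) N k =
      Re (\<Sum>a<m. complex_of_real (\<pi> a) * (\<Sum>j<m. ?M $$ (a, j) * complex_of_real (1 / sqrt (real m))))"
      using M unfolding classical_weight_def B_def[symmetric]
      by (simp add: scalar_prod_def lessThan_atLeast0 uniform_vec_def)
    also have "\<dots> = Re (complex_of_real (1 / sqrt (real m)) *
        (\<Sum>a<m. \<Sum>j<m. complex_of_real (\<pi> a) * ?M $$ (a, j)))"
      by (simp only: sum_distrib_left mult_ac)
    also have "\<dots> = Re (\<Sum>a<m. \<Sum>j<m. complex_of_real (\<pi> a) * ?M $$ (a, j)) / sqrt (real m)"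
      by (simp del: of_real_divide)
    finally show ?thesis using False by simp
  qed
  finally show ?thesis by simp
qed

section \<open>The entropy bound for the matrix product state\<close>

theorem theorem3p5:
  fixes m d N :: nat
    and \<pi> :: "nat \<Rightarrow> real"
    and U \<chi> :: "nat \<Rightarrow> complex mat"
    and A :: "nat \<Rightarrow> nat \<Rightarrow> complex mat"
  assumes pi_nonneg: "\<And>i. i < m \<Longrightarrow> \<pi> i \<ge> 0"
    and pi_sum: "(\<Sum>i<m. \<pi> i) = 1"
    and U_carrier: "\<And>n. n \<ge> 1 \<Longrightarrow> U n \<in> carrier_mat m m"
    and U_unitary: "\<And>n. n \<ge> 1 \<Longrightarrow> unitary_mat (U n)"
    and chi_carrier: "\<And>n. n \<ge> 1 \<Longrightarrow> \<chi> n \<in> carrier_mat m d"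
    and chi_norm: "\<And>n i. n \<ge> 1 \<Longrightarrow> i < m \<Longrightarrow> (\<Sum>k<d. (cmod (\<chi> n $$ (i, k)))\<^sup>2) = 1"
    and A_def: "A = ehmm_mat m U \<chi>"
    and N: "N \<ge> 1"
  shows "rel_entropy (mps_density m d A N) (ehmm_obs_density m d \<pi> U \<chi> N) \<ge>
    ereal (1 / real m) *
      (\<Sum>k \<in> label_seqs d N.
         log_ratio_term ((cmod (mps_coeff m A N k))\<^sup>2)
           (real m powr (3 / 2) * classical_weight m \<pi> A N k))"
proof -
  let ?\<psi> = "mps_vec m d A N" and ?\<sigma> = "ehmm_obs_density m d \<pi> U \<chi> N"
  have m: "m > 0" using pi_sum by (cases m) auto
  have "mps_density m d A N = complex_of_real (1 / real m) \<cdot>\<^sub>m ket_bra ?\<psi> ?\<psi>"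
    by (simp add: mps_density_def)
  moreover have "rel_entropy (complex_of_real (1 / real m) \<cdot>\<^sub>m ket_bra ?\<psi> ?\<psi>) ?\<sigma> \<ge>
    ereal (1 / real m) * (\<Sum>r<d ^ N. log_ratio_term ((cmod (?\<psi> $ r))\<^sup>2) (Re (?\<sigma> $$ (r, r)) / (1 / real m)))"
    \<comment> \<open>Here \<open>c = 1 / m\<close>, and the Gram vectors are the blocks of the
      hidden Markov state indexed by the position \<open>a\<close> in the hidden factor.\<close>
    by (rule rel_entropy_rank_one_ge_measured[OF mps_vec_carrier _ ehmm_obs_density_carrier
          ehmm_obs_density_index]) (use m in auto)
  moreover have "(\<Sum>r<d ^ N. log_ratio_term ((cmod (?\<psi> $ r))\<^sup>2) (Re (?\<sigma> $$ (r, r)) / (1 / real m))) =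
    (\<Sum>k\<in>label_seqs d N. log_ratio_term ((cmod (?\<psi> $ seq_pos d N k))\<^sup>2)
      (Re (?\<sigma> $$ (seq_pos d N k, seq_pos d N k)) / (1 / real m)))"
    by (rule sum.reindex_bij_betw[OF bij_betw_seq_pos, symmetric])
  moreover have "\<dots> = (\<Sum>k\<in>label_seqs d N. log_ratio_term ((cmod (mps_coeff m A N k))\<^sup>2)
      (real m powr (3 / 2) * classical_weight m \<pi> A N k))"
  proof (intro sum.cong refl)
    fix k assume k: "k \<in> label_seqs d N"
    \<comment> \<open>The factor \<open>m\<close> comes from dividing by \<open>c = 1 / m\<close>,
      and \<open>sqrt m\<close> from the normalisation of \<open>uniform_vec\<close>.\<close>
    have "real m powr (3 / 2) = real m powr (1 + 1 / 2)" by simp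
    also have "\<dots> = sqrt (real m) * real m"
      using m by (simp only: powr_add powr_half_sqrt) simp
    finally have "Re (?\<sigma> $$ (seq_pos d N k, seq_pos d N k)) / (1 / real m) =
      real m powr (3 / 2) * classical_weight m \<pi> A N k"
      using ehmm_obs_density_diagonal[OF k] classical_weight_eq[of m \<pi>, OF pi_nonneg]
      by (simp add: A_def)
    then show "log_ratio_term ((cmod (?\<psi> $ seq_pos d N k))\<^sup>2)
        (Re (?\<sigma> $$ (seq_pos d N k, seq_pos d N k)) / (1 / real m)) =
      log_ratio_term ((cmod (mps_coeff m A N k))\<^sup>2)
        (real m powr (3 / 2) * classical_weight m \<pi> A N k)"
      using k by (simp only: mps_vec_index)
  qed
  ultimately show ?thesis by (simp only:)
qed

end
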